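(* Consider the $L$-cell system with $K$ users per cell and $M$-antenna base stations described in the context, with local precoding vectors $\mathbf{w}_{lk}^{*}=\mathbf z_{lk}^{*}$ (i.e. $\mathbf w_{lk}=\mathbf z_{lk}$, the scaled least-squares channel estimate). Then for any given LSFP coefficients $\{a_{lk}^r\}$, the spectral efficiency of user $k$ in cell $l$ is $$R_{lk}=\frac{\tau_c-\tau_p}{\tau_c}\log_2(1+\mathrm{SINR}_{lk}),$$ $$\mathrm{SINR}_{lk}=\frac{|\boldsymbol a_{lk}^H\boldsymbol b_{lk}|^2}{\sum_{r=1}^L\boldsymbol a_{rk}^H\boldsymbol C_{lkk}\boldsymbol a_{rk}-|\boldsymbol a_{lk}^H\boldsymbol b_{lk}|^2+\sum_{r=1}^L\sum_{k'=1,k'\ne k}^K\boldsymbol a_{rk'}^H\boldsymbol C_{lkk'}\boldsymbol a_{rk'}+\sigma^2},$$ where $\boldsymbol a_{lk}=[a_{lk}^1,\dots,a_{lk}^L]^T$, $\boldsymbol b_{lk}=[b_{lk}^1,\dots,b_{lk}^L]^T\in\mathbb C^L$, $\boldsymbol C_{lkk'}\in\mathbb C^{L\times L}$ has $(r,n)$ entry $c_{lkk'}^{rn}$, and these elements are given by $$b_{lk}^{r}=\mathbb E\{\mathbf z_{rk}^H\mathbf g_{lk}^r\}=\sqrt{\tau_p\eta}\,\mathrm{tr}\left(\overline{\mathbf R}_{lk}^r\right),$$ $$c_{lkk}^{rr}=\mathbb E\{\mathbf z_{rk}^H\mathbf g_{lk}^r(\mathbf g_{lk}^r)^H\mathbf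 z_{rk}\}=\tau_p\eta\left(\mathrm{tr}(\mathbf R_{lk}^r)\right)^2+2\tau_p\eta\,(\bar{\mathbf g}_{lk}^r)^H\bar{\mathbf g}_{lk}^r\,\mathrm{tr}(\mathbf R_{lk}^r)+\mathrm{tr}\left(\mathbf\Psi_{rk}\overline{\mathbf R}_{lk}^r\right),$$ $$c_{lkk}^{rn}=\mathbb E\{\mathbf z_{rk}^H\mathbf g_{lk}^r(\mathbf g_{lk}^n)^H\mathbf z_{nk}\}=b_{lk}^r(b_{lk}^n)^*,\qquad r\neq n,$$ $$c_{lkk'}^{rr}=\mathbb E\{\mathbf z_{rk'}^H\mathbf g_{lk}^r(\mathbf g_{lk}^r)^H\mathbf z_{rk'}\}=\mathrm{tr}\left(\mathbf\Psi_{rk'}\overline{\mathbf R}_{lk}^r\right),\qquad k'\neq k,$$ $$c_{lkk'}^{rn}=\mathbb E\{\mathbf z_{rk'}^H\mathbf g_{lk}^r(\mathbf g_{lk}^n)^H\mathbf z_{nk'}\}=\mathbb E\{\mathbf z_{rk'}^H\}\,\mathbb E\{\mathbf g_{lk}^r\}\,\mathbb E\{(\mathbf g_{lk}^n)^H\}\,\mathbb E\{\mathbf z_{nk'}\}=0,\qquad k'\neq k,\ r\neq n.$$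
   Context: Indices: $l,r,n\in\{1,\dots,L\}$ are cells/base stations (BSs), $k,k'\in\{1,\dots,K\}$ are users. $M$ is the number of antennas per BS, $\tau_c$ the coherence block length, $\tau_p=K<\tau_c$ the pilot length, $\eta>0$ the pilot power, $\sigma^2>0$ the noise variance. $^*$ is complex conjugation, $^H$ conjugate transpose, $\mathrm{tr}$ trace. Channels: the channel between user $k$ in cell $l$ and BS $r$ is $\mathbf g_{lk}^r=e^{j\theta_{lk}^r}\bar{\mathbf g}_{lk}^r+\tilde{\mathbf g}_{lk}^r\in\mathbb C^M$, with $\bar{\mathbf g}_{lk}^r\in\mathbb C^M$ deterministic, $\theta_{lk}^r$ uniform on $[0,2\pi)$, and $\tilde{\mathbf g}_{lk}^r\sim\mathcal N_{\mathbb C}(\mathbf 0,\mathbf R_{lk}^r)$ circularly symmetric complex Gaussian with covariance matrix $\mathbf R_{lk}^r\in\mathbb C^{M\times M}$. Pilot observations: users with the same index $k$ in all cells share the same pilot, and distinct pilots are orthogonal, so that BS $l$ obtains $\mathbf z_{lk}=\sqrt{\tau_p\eta}\sum_{r=1}^L\mathbf g_{rk}^l+\tilde{\mathbf n}_{lk}$ with $\tilde{\mathbf n}_{lk}\sim\mathcal N_{\mathbb C}(\mathbf 0,\sigma^2\mathbf I_M)$. All the random variables $\theta_{lk}^r$, $\tilde{\mathbf g}_{lk}^r$, $\tilde{\mathbf n}_{lk}$ (over all indices) are mutually independent. Define $\overline{\mathbf R}_{lk}^r=\mathbb E\{\mathbf g_{lk}^r(\mathbf g_{lk}^r)^H\}=\mathbf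 R_{lk}^r+\bar{\mathbf g}_{lk}^r(\bar{\mathbf g}_{lk}^r)^H$ and $\mathbf\Psi_{lk}=\mathbb E\{\mathbf z_{lk}\mathbf z_{lk}^H\}=\tau_p\eta\sum_{r=1}^L\overline{\mathbf R}_{rk}^l+\sigma^2\mathbf I_M$. Two-layer precoding and spectral efficiency: large-scale fading precoding (LSFP) uses deterministic weights $a_{lk}^r\in\mathbb C$ (the conjugate $(a_{lk}^r)^*$ is applied at BS $r$ to the symbol of user $k$ in cell $l$); BS $r$ then uses local precoding vectors $\mathbf w_{rk}^*$, one for each pilot index $k$. The spectral efficiency (SE) of user $k$ in cell $l$ is by definition $R_{lk}=\frac{\tau_c-\tau_p}{\tau_c}\log_2(1+\mathrm{SINR}_{lk})$ with $$\mathrm{SINR}_{lk}=\frac{|\mathrm{DS}_{lk}|^2}{\mathbb E\{|\mathrm{BU}_{lk}|^2\}+\sum_{r\neq l}\mathbb E\{|\mathrm{PC}_{lk}^r|^2\}+\sum_{r=1}^L\sum_{k'\neq k}\mathbb E\{|\mathrm{NI}_{lk}^{rk'}|^2\}+\sigma^2},$$ where $\mathrm{DS}_{lk}=\sum_{r}(a_{lk}^r)^*\mathbb E\{\mathbf w_{rk}^H\mathbf g_{lk}^r\}$, $\mathrm{BU}_{lk}=\sum_r(a_{lk}^r)^*(\mathbf w_{rk}^H\mathbf g_{lk}^r-\mathbb E\{\mathbf w_{rk}^H\mathbf g_{lk}^r\})$, $\mathrm{PC}_{lk}^r=\sum_n(a_{rk}^n)^*\mathbf w_{nk}^H\mathbf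 g_{lk}^n$, $\mathrm{NI}_{lk}^{rk'}=\sum_n(a_{rk'}^n)^*\mathbf w_{nk'}^H\mathbf g_{lk}^n$. In general, for local precoders $\mathbf w$, $b_{lk}^r=\mathbb E\{\mathbf w_{rk}^H\mathbf g_{lk}^r\}$ and $c_{lkk'}^{rn}=\mathbb E\{\mathbf w_{rk'}^H\mathbf g_{lk}^r(\mathbf g_{lk}^n)^H\mathbf w_{nk'}\}$. *)

theory Defs
  imports "HOL-Probability.Probability"
begin

section \<open>Complex vectors and matrices\<close>

definition hdot :: "complex ^ 'n \<Rightarrow> complex ^ 'n \<Rightarrow> complex" where
  "hdot x y = (\<Sum>i\<in>UNIV. cnj (x $ i) * y $ i)"  (* x^H y *)

definition outer :: "complex ^ 'n \<Rightarrow> complex ^ 'n \<Rightarrow> complex ^ 'n ^ 'n" where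
  "outer x y = (\<chi> i j. x $ i * cnj (y $ j))"  (* x y^H *)


section \<open>Gaussian vectors\<close>

definition real_gaussian :: "'w measure \<Rightarrow> ('w \<Rightarrow> real) \<Rightarrow> bool" where
  "real_gaussian M X \<longleftrightarrow> X \<in> borel_measurable M \<and>
     ((\<exists>\<mu> s. 0 < s \<and> distributed M lborel X (normal_density \<mu> s)) \<or> (\<exists>\<mu>. AE w in M. X w = \<mu>))"

text \<open>
  The law \<open>N\<^sub>\<complex>(0, R)\<close>. The operation \<open>\<bullet>\<close> is the real inner product
  \<open>v \<bullet> x = Re (hdot v x)\<close>, so the second conjunct says that the real and imaginary parts
  of the entries of \<open>X\<close> are jointly Gaussian. Degenerate Gaussians are admitted, so \<open>R\<close> may be
  singular (even zero); that it is Hermitian and positive semidefinite follows from the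
  last conjunct.
\<close>

definition circ_gaussian :: "'w measure \<Rightarrow> ('w \<Rightarrow> complex ^ 'n) \<Rightarrow> complex ^ 'n ^ 'n \<Rightarrow> bool" where
  "circ_gaussian M X R \<longleftrightarrow> X \<in> borel_measurable M \<and>
     (\<forall>v. real_gaussian M (\<lambda>w. v \<bullet> X w)) \<and>
     (\<forall>t. distr M borel (\<lambda>w. cis t *s X w) = distr M borel X) \<and>
     (\<integral>w. X w \<partial>M) = 0 \<and>
     (\<integral>w. outer (X w) (X w) \<partial>M) = R"


section \<open>Channels and pilot observations\<close>

text \<open>
  Cells and base stations are the elements of \<open>'l\<close>, users (and pilots) those of \<open>'k\<close>, antennas
  those of \<open>'m\<close>. The arguments of a quantity with subscripts \<open>l, k\<close> and superscript \<open>r\<close> come in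
  the order \<open>l k r\<close>: \<open>g l k r\<close> is the channel between user \<open>k\<close> in cell \<open>l\<close> and base station \<open>r\<close>.
\<close>

definition channel ::
  "('l \<Rightarrow> 'k \<Rightarrow> 'l \<Rightarrow> 'w \<Rightarrow> real) \<Rightarrow> ('l \<Rightarrow> 'k \<Rightarrow> 'l \<Rightarrow> complex ^ 'm) \<Rightarrow>
   ('l \<Rightarrow> 'k \<Rightarrow> 'l \<Rightarrow> 'w \<Rightarrow> complex ^ 'm) \<Rightarrow> 'l \<Rightarrow> 'k \<Rightarrow> 'l \<Rightarrow> 'w \<Rightarrow> complex ^ 'm" where
  "channel \<theta> gbar gt l k r w = cis (\<theta> l k r w) *s gbar l k r + gt l k r w"

definition pilot_obs ::
  "nat \<Rightarrow> real \<Rightarrow> ('l::finite \<Rightarrow> 'k \<Rightarrow> 'l \<Rightarrow> 'w \<Rightarrow> complex ^ 'm) \<Rightarrow>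
   ('l \<Rightarrow> 'k \<Rightarrow> 'w \<Rightarrow> complex ^ 'm) \<Rightarrow> 'l \<Rightarrow> 'k \<Rightarrow> 'w \<Rightarrow> complex ^ 'm" where
  "pilot_obs \<tau>p \<eta> g nn l k w =
     complex_of_real (sqrt (real \<tau>p * \<eta>)) *s (\<Sum>r\<in>UNIV. g r k l w) + nn l k w"

text \<open>
  The phases are real valued, the other sources of randomness vector valued. Their mutual
  independence is therefore stated through the generated families of events; it is what
  \<^term>\<open>prob_space.indep_vars\<close> unfolds to for variables with a common codomain.
\<close>

datatype ('l, 'k) source = Phase 'l 'k 'l | Scatter 'l 'k 'l | Noise 'l 'k

definition source_events ::
  "'w measure \<Rightarrow> ('l \<Rightarrow> 'k \<Rightarrow> 'l \<Rightarrow> 'w \<Rightarrow> real) \<Rightarrow> ('l \<Rightarrow> 'k \<Rightarrow> 'l \<Rightarrow> 'w \<Rightarrow> complex ^ 'm) \<Rightarrow>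
   ('l \<Rightarrow> 'k \<Rightarrow> 'w \<Rightarrow> complex ^ 'm) \<Rightarrow> ('l, 'k) source \<Rightarrow> 'w set set" where
  "source_events M \<theta> gt nn s = (case s of
       Phase l k r \<Rightarrow> {\<theta> l k r -` A \<inter> space M | A. A \<in> sets borel}
     | Scatter l k r \<Rightarrow> {gt l k r -` A \<inter> space M | A. A \<in> sets borel}
     | Noise l k \<Rightarrow> {nn l k -` A \<inter> space M | A. A \<in> sets borel})"

definition second_moment :: "'w measure \<Rightarrow> ('w \<Rightarrow> complex ^ 'm) \<Rightarrow> complex ^ 'm ^ 'm" where
  "second_moment M X = (\<integral>w. outer (X w) (X w) \<partial>M)"


section \<open>Spectral efficiency under two-layer precoding\<close>

text \<open>
  In this section \<open>w r k\<close> is an arbitrary (random) local precoder of base station \<open>r\<close> for pilot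
  \<open>k\<close>, and \<open>a l k\<close> is the vector with entries \<open>a\<^sub>l\<^sub>k\<^sup>1, \<dots>, a\<^sub>l\<^sub>k\<^sup>L\<close>.
\<close>

definition DS where
  "DS M a w g l k = (\<Sum>r\<in>UNIV. cnj (a l k $ r) * (\<integral>x. hdot (w r k x) (g l k r x) \<partial>M))"

definition BU where
  "BU M a w g l k x = (\<Sum>r\<in>UNIV. cnj (a l k $ r) *
     (hdot (w r k x) (g l k r x) - (\<integral>y. hdot (w r k y) (g l k r y) \<partial>M)))"

definition PC where
  "PC a w g l k r x = (\<Sum>n\<in>UNIV. cnj (a r k $ n) * hdot (w n k x) (g l k n x))"

definition NI where
  "NI a w g l k r k' x = (\<Sum>n\<in>UNIV. cnj (a r k' $ n) * hdot (w n k' x) (g l k n x))"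

definition SINR ::
  "'w measure \<Rightarrow> real \<Rightarrow> ('l::finite \<Rightarrow> 'k::finite \<Rightarrow> complex ^ 'l) \<Rightarrow>
   ('l \<Rightarrow> 'k \<Rightarrow> 'w \<Rightarrow> complex ^ 'm) \<Rightarrow> ('l \<Rightarrow> 'k \<Rightarrow> 'l \<Rightarrow> 'w \<Rightarrow> complex ^ 'm) \<Rightarrow>
   'l \<Rightarrow> 'k \<Rightarrow> real" where
  "SINR M \<sigma> a w g l k = (cmod (DS M a w g l k))\<^sup>2 /
     ((\<integral>x. (cmod (BU M a w g l k x))\<^sup>2 \<partial>M)
      + (\<Sum>r\<in>UNIV - {l}. \<integral>x. (cmod (PC a w g l k r x))\<^sup>2 \<partial>M)
      + (\<Sum>r\<in>UNIV. \<Sum>k'\<in>UNIV - {k}. \<integral>x. (cmod (NI a w g l k r k' x))\<^sup>2 \<partial>M)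
      + \<sigma>\<^sup>2)"

definition spectral_efficiency ::
  "'w measure \<Rightarrow> nat \<Rightarrow> nat \<Rightarrow> real \<Rightarrow> ('l::finite \<Rightarrow> 'k::finite \<Rightarrow> complex ^ 'l) \<Rightarrow>
   ('l \<Rightarrow> 'k \<Rightarrow> 'w \<Rightarrow> complex ^ 'm) \<Rightarrow> ('l \<Rightarrow> 'k \<Rightarrow> 'l \<Rightarrow> 'w \<Rightarrow> complex ^ 'm) \<Rightarrow>
   'l \<Rightarrow> 'k \<Rightarrow> real" where
  "spectral_efficiency M \<tau>c \<tau>p \<sigma> a w g l k =
     (real \<tau>c - real \<tau>p) / real \<tau>c * log 2 (1 + SINR M \<sigma> a w g l k)"

definition b_vec ::
  "'w measure \<Rightarrow> ('l \<Rightarrow> 'k \<Rightarrow> 'w \<Rightarrow> complex ^ 'm) \<Rightarrow>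
   ('l \<Rightarrow> 'k \<Rightarrow> 'l \<Rightarrow> 'w \<Rightarrow> complex ^ 'm) \<Rightarrow> 'l \<Rightarrow> 'k \<Rightarrow> complex ^ 'l" where
  "b_vec M w g l k = (\<chi> r. \<integral>x. hdot (w r k x) (g l k r x) \<partial>M)"

definition C_mat ::
  "'w measure \<Rightarrow> ('l \<Rightarrow> 'k \<Rightarrow> 'w \<Rightarrow> complex ^ 'm) \<Rightarrow>
   ('l \<Rightarrow> 'k \<Rightarrow> 'l \<Rightarrow> 'w \<Rightarrow> complex ^ 'm) \<Rightarrow> 'l \<Rightarrow> 'k \<Rightarrow> 'k \<Rightarrow> complex ^ 'l ^ 'l" where
  "C_mat M w g l k k' =
     (\<chi> r n. \<integral>x. hdot (w r k' x) (g l k r x) * hdot (g l k n x) (w n k' x) \<partial>M)"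


section \<open>Closed forms of the second moments\<close>

text \<open>
  The lemmas \<open>second_moment_channel\<close> and \<open>second_moment_pilot_obs\<close> below give the usual
  expressions of the correlation matrices of \<open>g l k r\<close> and \<open>z l k\<close> in terms of \<open>R\<close>, \<open>gbar\<close>
  and \<open>\<sigma>\<close>.
\<close>

lemma measurable_nth [measurable (raw)]:
  fixes X :: "'w \<Rightarrow> complex ^ 'm"
  assumes "X \<in> borel_measurable M"
  shows "(\<lambda>w. X w $ i) \<in> borel_measurable M"
  by (rule measurable_compose[OF assms]) (intro borel_measurable_continuous_onI continuous_intros)

lemma measurable_cis [measurable]: "cis \<in> borel_measurable borel"
  by (intro borel_measurable_continuous_onI continuous_intros)

lemma measurable_cnj [measurable]: "cnj \<in> borel_measurable borel"
  by (intro borel_measurable_continuous_onI continuous_intros)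

definition sq_int :: "'w measure \<Rightarrow> ('w \<Rightarrow> complex) \<Rightarrow> bool" where
  "sq_int M f \<longleftrightarrow> f \<in> borel_measurable M \<and> integrable M (\<lambda>w. (cmod (f w))\<^sup>2)"

lemma sq_int_mult:
  assumes "sq_int M f" "sq_int M h"
  shows "integrable M (\<lambda>w. f w * cnj (h w))"
proof (rule Bochner_Integration.integrable_bound)
  show "integrable M (\<lambda>w. (cmod (f w))\<^sup>2 + (cmod (h w))\<^sup>2)"
    using assms by (auto simp: sq_int_def)
  have [measurable]: "f \<in> borel_measurable M" "h \<in> borel_measurable M"
    using assms by (auto simp: sq_int_def)
  show "(\<lambda>w. f w * cnj (h w)) \<in> borel_measurable M"
    by (intro borel_measurable_times measurable_compose[OF _ measurable_cnj]) auto
  have "a * b \<le> a\<^sup>2 + b\<^sup>2" if "0 \<le> a" "0 \<le> b" for a b :: real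
    using sum_squares_bound[of a b] mult_nonneg_nonneg[OF that] by linarith
  then show "AE w in M. norm (f w * cnj (h w)) \<le> norm ((cmod (f w))\<^sup>2 + (cmod (h w))\<^sup>2)"
    by (auto simp: norm_mult)
qed

lemma (in prob_space) sq_int_integrable:
  assumes "sq_int M f" shows "integrable M f"
proof -
  have "sq_int M (\<lambda>_. 1)" by (simp add: sq_int_def)
  from sq_int_mult[OF assms this] show ?thesis by simp
qed

lemma (in prob_space) real_gaussian_sq_integrable:
  assumes "real_gaussian M X"
  shows "integrable M (\<lambda>w. (X w)\<^sup>2)"
proof -
  have [measurable]: "X \<in> borel_measurable M" using assms by (simp add: real_gaussian_def)
  consider \<mu> s where "0 < s" "distributed M lborel X (normal_density \<mu> s)"
    | \<mu> where "AE w in M. X w = \<mu>"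
    using assms by (auto simp: real_gaussian_def)
  then show ?thesis
  proof cases
    case 1
    have *: "integrable M (\<lambda>w. (X w - \<mu>) ^ n)" for n
      using distributed_integrable[OF 1(2), of "\<lambda>x. (x - \<mu>) ^ n"]
        integrable_normal_moment[OF 1(1), of \<mu> n] by simp
    have eq: "(X w)\<^sup>2 = (X w - \<mu>) ^ 2 + 2 * \<mu> * (X w - \<mu>) ^ 1 + \<mu>\<^sup>2" for w
      by (simp add: power2_eq_square algebra_simps)
    show ?thesis unfolding eq
      by (intro Bochner_Integration.integrable_add integrable_mult_right * integrable_const)
  next
    case 2
    have "integrable M (\<lambda>w. (X w)\<^sup>2) \<longleftrightarrow> integrable M (\<lambda>w. \<mu>\<^sup>2)"
      using 2 by (intro integrable_cong_AE) auto
    then show ?thesis by simp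
  qed
qed

lemma (in prob_space) circ_gaussian_sq_int:
  fixes X :: "'a \<Rightarrow> complex ^ 'm"
  assumes "circ_gaussian M X R"
  shows "sq_int M (\<lambda>w. X w $ i)"
proof -
  have [measurable]: "X \<in> borel_measurable M"
    and G: "\<And>v. real_gaussian M (\<lambda>w. v \<bullet> X w)" using assms by (auto simp: circ_gaussian_def)
  have "integrable M (\<lambda>w. (axis i 1 \<bullet> X w)\<^sup>2 + (axis i \<i> \<bullet> X w)\<^sup>2)"
    by (intro Bochner_Integration.integrable_add real_gaussian_sq_integrable G)
  moreover have "(axis i 1 \<bullet> X w)\<^sup>2 + (axis i \<i> \<bullet> X w)\<^sup>2 = (cmod (X w $ i))\<^sup>2" for w
    by (simp add: inner_axis' inner_complex_def cmod_power2)
  ultimately show ?thesis by (simp add: sq_int_def)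
qed

lemma (in prob_space) integral_uniform_phase:
  assumes "distributed M lborel T (\<lambda>t. indicator {0..<2 * pi} t / (2 * pi))"
  shows "(\<integral>w. cis (T w) \<partial>M) = 0"
proof -
  have [measurable]: "T \<in> borel_measurable M"
    using distributed_measurable[OF assms] by simp
  have *: "(\<integral>w. h (T w) \<partial>M) = 0"
    if H: "\<And>x. (H has_real_derivative h x) (at x)" "\<And>x. isCont h x" "H 0 = H (2 * pi)" for h H :: "real \<Rightarrow> real"
  proof -
    have h[measurable]: "h \<in> borel_measurable borel"
      using H(2) by (intro borel_measurable_continuous_onI continuous_at_imp_continuous_on) auto
    have "(\<integral>w. h (T w) \<partial>M) = (\<integral>x. indicator {0..<2 * pi} x / (2 * pi) * h x \<partial>lborel)"
      by (rule distributed_integral[OF assms, symmetric]) auto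
    also have "\<dots> = (\<integral>x. (h x * indicator {0..2 * pi} x) / (2 * pi) \<partial>lborel)"
      by (rule integral_cong_AE)
        (use AE_lborel_singleton[of "2 * pi"] in \<open>auto simp: indicator_def elim: eventually_mono\<close>)
    also have "\<dots> = (\<integral>x. h x * indicator {0..2 * pi} x \<partial>lborel) / (2 * pi)"
      by simp
    also have "(\<integral>x. h x * indicator {0..2 * pi} x \<partial>lborel) = H (2 * pi) - H 0"
      by (rule integral_FTC_Icc_real) (use H in auto)
    finally show ?thesis using H(3) by simp
  qed
  have int: "integrable M (\<lambda>w. cis (T w))"
    by (rule integrable_const_bound[where B = 1])
      (auto intro: measurable_compose[OF _ measurable_cis])
  have c: "(\<integral>w. cos (T w) \<partial>M) = 0"
    by (rule *[of sin]) (auto intro!: derivative_eq_intros)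
  have s: "(\<integral>w. sin (T w) \<partial>M) = 0"
    by (rule *[of "\<lambda>x. - cos x"]) (auto intro!: derivative_eq_intros)
  show ?thesis
    using c s integral_Re[OF int] integral_Im[OF int] by (simp add: complex_eq_iff)
qed

lemma finite_source: "finite (UNIV :: ('l::finite, 'k::finite) source set)"
proof -
  have "(UNIV :: ('l, 'k) source set) =
      range (\<lambda>(l, k, r). Phase l k r) \<union> range (\<lambda>(l, k, r). Scatter l k r)
      \<union> range (\<lambda>(l, k). Noise l k)"
  proof (intro set_eqI iffI)
    fix s :: "('l, 'k) source"
    show "s \<in> range (\<lambda>(l, k, r). Phase l k r) \<union> range (\<lambda>(l, k, r). Scatter l k r)
        \<union> range (\<lambda>(l, k). Noise l k)"
      by (cases s) (auto simp: image_iff)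
  qed auto
  then show ?thesis by (metis finite finite_Un finite_imageI)
qed

text \<open>The additive contribution of each source to the received signals.\<close>

definition source_vec ::
  "('l \<Rightarrow> 'k \<Rightarrow> 'l \<Rightarrow> 'w \<Rightarrow> real) \<Rightarrow> ('l \<Rightarrow> 'k \<Rightarrow> 'l \<Rightarrow> complex ^ 'm) \<Rightarrow>
   ('l \<Rightarrow> 'k \<Rightarrow> 'l \<Rightarrow> 'w \<Rightarrow> complex ^ 'm) \<Rightarrow> ('l \<Rightarrow> 'k \<Rightarrow> 'w \<Rightarrow> complex ^ 'm) \<Rightarrow>
   ('l, 'k) source \<Rightarrow> 'w \<Rightarrow> complex ^ 'm" where
  "source_vec \<theta> gbar gt nn s w = (case s of
       Phase l k r \<Rightarrow> cis (\<theta> l k r w) *s gbar l k r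
     | Scatter l k r \<Rightarrow> gt l k r w
     | Noise l k \<Rightarrow> nn l k w)"

lemma vimage_compose_event:
  assumes "f \<in> borel_measurable borel" "A \<in> sets borel"
  shows "\<exists>B. (\<lambda>w. f (X w)) -` A \<inter> S = X -` B \<inter> S \<and> B \<in> sets borel"
  by (rule exI[of _ "f -` A"]) (use measurable_sets[OF assms] in auto)

lemma source_vec_events:
  fixes gt :: "'l \<Rightarrow> 'k \<Rightarrow> 'l \<Rightarrow> 'w \<Rightarrow> complex ^ 'm"
  assumes "h \<in> borel_measurable borel" "A \<in> sets borel"
  shows "(\<lambda>w. h (source_vec \<theta> gbar gt nn s w $ i)) -` A \<inter> space M \<in> source_events M \<theta> gt nn s"
proof (cases s)
  case (Phase l k r)
  have "(\<lambda>t. h (cis t * gbar l k r $ i)) \<in> borel_measurable borel"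
    using assms(1) by measurable
  from vimage_compose_event[OF this assms(2), of "\<theta> l k r" "space M"] show ?thesis
    by (simp add: Phase source_vec_def source_events_def)
next
  case (Scatter l k r)
  have "(\<lambda>t :: complex ^ 'm. h (t $ i)) \<in> borel_measurable borel"
    using assms(1) by measurable
  from vimage_compose_event[OF this assms(2), of "gt l k r" "space M"] show ?thesis
    by (simp add: Scatter source_vec_def source_events_def)
next
  case (Noise l k)
  have "(\<lambda>t :: complex ^ 'm. h (t $ i)) \<in> borel_measurable borel"
    using assms(1) by measurable
  from vimage_compose_event[OF this assms(2), of "nn l k" "space M"] show ?thesis
    by (simp add: Noise source_vec_def source_events_def)
qed

lemma (in prob_space) source_vec_indep:
  fixes h h' :: "complex \<Rightarrow> complex"
  assumes ind: "indep_sets (source_events M \<theta> gt nn) UNIV" and st: "s \<noteq> t"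
    and [measurable]: "h \<in> borel_measurable borel" "h' \<in> borel_measurable borel"
      "source_vec \<theta> gbar gt nn s \<in> borel_measurable M"
      "source_vec \<theta> gbar gt nn t \<in> borel_measurable M"
  shows "indep_var borel (\<lambda>w. h (source_vec \<theta> gbar gt nn s w $ i))
           borel (\<lambda>w. h' (source_vec \<theta> gbar gt nn t w $ j))"
proof -
  have st_ind: "prob (a \<inter> b) = prob a * prob b"
    if "a \<in> source_events M \<theta> gt nn s" "b \<in> source_events M \<theta> gt nn t" for a b
    using indep_setsD[OF ind, of "{s, t}" "\<lambda>x. if x = s then a else b"] that st
    by (auto simp: Int_commute)
  have Int_st: "Int_stable {X -` A \<inter> space M |A. A \<in> sets borel}" for X :: "'a \<Rightarrow> complex"
  proof (rule Int_stableI, clarify)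
    fix A B :: "complex set" assume "A \<in> sets borel" "B \<in> sets borel"
    then show "\<exists>C. X -` A \<inter> space M \<inter> (X -` B \<inter> space M) = X -` C \<inter> space M \<and> C \<in> sets borel"
      by (intro exI[of _ "A \<inter> B"]) auto
  qed
  show ?thesis
    unfolding indep_var_eq
    by (intro conjI indep_set_sigma_sets Int_st indep_setI)
      (auto intro!: st_ind source_vec_events measurable_sets[of _ M borel])
qed

context prob_space
begin

context
  fixes \<theta> :: "'l::finite \<Rightarrow> 'k::finite \<Rightarrow> 'l \<Rightarrow> 'a \<Rightarrow> real"
    and gbar :: "'l \<Rightarrow> 'k \<Rightarrow> 'l \<Rightarrow> complex ^ 'm"
    and gt :: "'l \<Rightarrow> 'k \<Rightarrow> 'l \<Rightarrow> 'a \<Rightarrow> complex ^ 'm"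
    and nn :: "'l \<Rightarrow> 'k \<Rightarrow> 'a \<Rightarrow> complex ^ 'm"
    and R :: "'l \<Rightarrow> 'k \<Rightarrow> 'l \<Rightarrow> complex ^ 'm ^ 'm"
    and \<sigma> :: real
  assumes phase: "\<And>l k r. distributed M lborel (\<theta> l k r)
            (\<lambda>t. indicator {0..<2 * pi} t / (2 * pi))"
    and scatter: "\<And>l k r. circ_gaussian M (gt l k r) (R l k r)"
    and noise: "\<And>l k. circ_gaussian M (nn l k) (mat (complex_of_real (\<sigma>\<^sup>2)))"
    and ind: "indep_sets (source_events M \<theta> gt nn) UNIV"
begin

private abbreviation V where "V \<equiv> source_vec \<theta> gbar gt nn"

private definition cov where
  "cov s = (case s of
       Phase l k r \<Rightarrow> outer (gbar l k r) (gbar l k r)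
     | Scatter l k r \<Rightarrow> R l k r
     | Noise l k \<Rightarrow> mat (complex_of_real (\<sigma>\<^sup>2)))"

private lemma meas_theta [measurable]: "\<theta> l k r \<in> borel_measurable M"
  using distributed_measurable[OF phase] by simp

private lemma V_measurable [measurable]: "V s \<in> borel_measurable M"
proof (cases s)
  case (Phase l k r)
  have "continuous_on UNIV (\<lambda>c :: complex. c *s gbar l k r)"
    unfolding vector_scalar_mult_def by (intro continuous_intros)
  then have "(\<lambda>c. c *s gbar l k r) \<in> borel_measurable borel"
    by (rule borel_measurable_continuous_onI)
  then have "(\<lambda>w. cis (\<theta> l k r w) *s gbar l k r) \<in> borel_measurable M"
    by measurable
  then show ?thesis by (simp add: Phase source_vec_def[abs_def])
qed (use scatter noise in \<open>auto simp: source_vec_def[abs_def] circ_gaussian_def\<close>)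

private lemma V_sq_int: "sq_int M (\<lambda>w. V s w $ i)"
proof (cases s)
  case (Phase l k r)
  have "(\<lambda>w. V s w $ i) \<in> borel_measurable M" by measurable
  then show ?thesis by (simp add: Phase source_vec_def sq_int_def norm_mult)
qed (use circ_gaussian_sq_int[OF scatter] circ_gaussian_sq_int[OF noise] in
      \<open>auto simp: source_vec_def\<close>)

private lemma integrable_vecI:
  fixes f :: "'a \<Rightarrow> 'b::euclidean_space ^ 'n"
  assumes "\<And>i. integrable M (\<lambda>w. f w $ i)" shows "integrable M f"
proof -
  have "integrable M (\<lambda>w. \<Sum>b\<in>Basis. (f w \<bullet> b) *\<^sub>R b)"
  proof (intro Bochner_Integration.integrable_sum integrable_scaleR_left)
    fix b :: "'b ^ 'n" assume "b \<in> Basis"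
    then obtain i c where "b = axis i c" by (auto simp: Basis_vec_def)
    then show "integrable M (\<lambda>w. f w \<bullet> b)"
      using integrable_bounded_linear[OF bounded_linear_inner_left assms, of i c]
      by (simp add: inner_axis)
  qed
  then show ?thesis by (simp add: euclidean_representation)
qed

private lemma integral_nth:
  fixes f :: "'a \<Rightarrow> 'b::euclidean_space ^ 'n"
  assumes "integrable M f" shows "(\<integral>w. f w \<partial>M) $ i = (\<integral>w. f w $ i \<partial>M)"
  using integral_bounded_linear[OF bounded_linear_vec_nth assms] by simp

private lemma integrable_outer: "integrable M (\<lambda>w. outer (V s w) (V t w))"
  by (intro integrable_vecI) (simp add: outer_def sq_int_mult V_sq_int)

private lemma integral_outer:
  "(\<integral>w. outer (V s w) (V t w) \<partial>M) $ i $ j = (\<integral>w. V s w $ i * cnj (V t w $ j) \<partial>M)"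
proof -
  have "integrable M (\<lambda>w. outer (V s w) (V t w) $ i)"
    by (intro integrable_vecI) (simp add: outer_def sq_int_mult V_sq_int)
  then show ?thesis
    by (simp add: integral_nth integrable_outer) (simp add: outer_def)
qed

private lemma V_mean: "(\<integral>w. V s w $ i \<partial>M) = 0"
proof (cases s)
  case (Phase l k r)
  then show ?thesis by (simp add: source_vec_def integral_uniform_phase[OF phase])
next
  case (Scatter l k r)
  have "integrable M (gt l k r)"
    by (intro integrable_vecI sq_int_integrable circ_gaussian_sq_int[OF scatter])
  from integral_nth[OF this] show ?thesis
    using scatter by (simp add: Scatter source_vec_def circ_gaussian_def flip: integral_nth)
next
  case (Noise l k)
  have "integrable M (nn l k)"
    by (intro integrable_vecI sq_int_integrable circ_gaussian_sq_int[OF noise])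
  from integral_nth[OF this] show ?thesis
    using noise by (simp add: Noise source_vec_def circ_gaussian_def flip: integral_nth)
qed

private lemma cross_moment:
  "(\<integral>w. V s w $ i * cnj (V t w $ j) \<partial>M) = (if s = t then cov s $ i $ j else 0)"
proof (cases "s = t")
  case True
  have "cov s = (\<integral>w. outer (V s w) (V s w) \<partial>M)"
  proof (cases s)
    case (Phase l k r)
    have "outer (V s w) (V s w) = outer (gbar l k r) (gbar l k r)" for w
      by (simp add: Phase source_vec_def outer_def vec_eq_iff cis_cnj cis_mult)
    then show ?thesis by (simp add: Phase cov_def prob_space)
  qed (use scatter noise in \<open>auto simp: source_vec_def cov_def circ_gaussian_def\<close>)
  with True show ?thesis using integral_outer[of s s i j] by simp
next
  case False
  have "(\<integral>w. V s w $ i * cnj (V t w $ j) \<partial>M) = (\<integral>w. V s w $ i \<partial>M) * (\<integral>w. cnj (V t w $ j) \<partial>M)"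
  proof (rule indep_var_lebesgue_integral)
    show "indep_var borel (\<lambda>w. V s w $ i) borel (\<lambda>w. cnj (V t w $ j))"
      by (rule source_vec_indep[OF ind False, where h = "\<lambda>x. x"]) auto
    show "integrable M (\<lambda>w. V s w $ i)" "integrable M (\<lambda>w. cnj (V t w $ j))"
      using sq_int_integrable[OF V_sq_int] by auto
  qed
  with False show ?thesis by (simp add: V_mean)
qed

private lemma second_moment_sum:
  fixes c :: "('l, 'k) source \<Rightarrow> complex"
  assumes X: "\<And>w i. X w $ i = (\<Sum>s\<in>S. c s * V s w $ i)"
  shows "second_moment M X $ i $ j = (\<Sum>s\<in>S. c s * cnj (c s) * cov s $ i $ j)"
proof -
  have fin: "finite S"
    by (rule finite_subset[OF subset_UNIV]) (rule finite_source)
  have eq: "outer (X w) (X w) $ i $ j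
      = (\<Sum>s\<in>S. \<Sum>t\<in>S. c s * cnj (c t) * (V s w $ i * cnj (V t w $ j)))" for w i j
    by (simp add: outer_def X sum_product mult_ac)
  have int: "integrable M (\<lambda>w. outer (X w) (X w) $ i $ j)" for i j
    unfolding eq by (intro Bochner_Integration.integrable_sum integrable_mult_right sq_int_mult V_sq_int)
  have "second_moment M X $ i $ j = (\<integral>w. outer (X w) (X w) $ i $ j \<partial>M)"
    unfolding second_moment_def by (simp add: integral_nth integrable_vecI int)
  also have "\<dots> = (\<Sum>s\<in>S. \<Sum>t\<in>S. c s * cnj (c t) * (\<integral>w. V s w $ i * cnj (V t w $ j) \<partial>M))"
    unfolding eq by (subst Bochner_Integration.integral_sum;
        (intro Bochner_Integration.integrable_sum integrable_mult_right sq_int_mult V_sq_int)?)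
      (subst Bochner_Integration.integral_sum; simp add: sq_int_mult V_sq_int)
  also have "\<dots> = (\<Sum>s\<in>S. c s * cnj (c s) * cov s $ i $ j)"
    by (simp add: cross_moment if_distrib[of "\<lambda>x. _ * x"] fin cong: if_cong)
  finally show ?thesis .
qed

lemma second_moment_channel:
  "second_moment M (channel \<theta> gbar gt l k r) = R l k r + outer (gbar l k r) (gbar l k r)"
proof -
  have "second_moment M (channel \<theta> gbar gt l k r) $ i $ j
      = (\<Sum>s\<in>{Phase l k r, Scatter l k r}. 1 * cnj 1 * cov s $ i $ j)" for i j
    by (rule second_moment_sum) (simp add: channel_def source_vec_def)
  then show ?thesis by (simp add: vec_eq_iff cov_def)
qed

lemma second_moment_pilot_obs:
  assumes "0 \<le> \<eta>"
  shows "second_moment M (pilot_obs \<tau>p \<eta> (channel \<theta> gbar gt) nn l k)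
       = (\<Sum>r\<in>UNIV. (real \<tau>p * \<eta>) *\<^sub>R second_moment M (channel \<theta> gbar gt r k l))
         + mat (complex_of_real (\<sigma>\<^sup>2))"
proof -
  define q where "q = complex_of_real (sqrt (real \<tau>p * \<eta>))"
  define c where "c s = (case s of Noise _ _ \<Rightarrow> 1 | _ \<Rightarrow> q)" for s :: "('l, 'k) source"
  define S where "S = range (\<lambda>r. Phase r k l) \<union> range (\<lambda>r. Scatter r k l) \<union> {Noise l k}"
  have qq: "q * cnj q = complex_of_real (real \<tau>p * \<eta>)"
    using assms unfolding q_def by (simp flip: of_real_mult)
  have sumS: "(\<Sum>s\<in>S. f s) = (\<Sum>r\<in>UNIV. f (Phase r k l)) + (\<Sum>r\<in>UNIV. f (Scatter r k l)) + f (Noise l k)"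
    for f :: "_ \<Rightarrow> complex"
    unfolding S_def by (subst sum.union_disjoint; auto simp: sum.reindex inj_def)+
  have "second_moment M (pilot_obs \<tau>p \<eta> (channel \<theta> gbar gt) nn l k) $ i $ j
      = (\<Sum>s\<in>S. c s * cnj (c s) * cov s $ i $ j)" for i j
    by (rule second_moment_sum)
      (simp add: sumS c_def pilot_obs_def channel_def source_vec_def q_def
        sum.distrib sum_distrib_left algebra_simps)
  moreover have "(\<Sum>r\<in>UNIV. (real \<tau>p * \<eta>) *\<^sub>R second_moment M (channel \<theta> gbar gt r k l)) $ i $ j
      = (\<Sum>r\<in>UNIV. q * cnj q * (R r k l $ i $ j + outer (gbar r k l) (gbar r k l) $ i $ j))" for i j
    by (simp only: sum_component vector_scaleR_component second_moment_channel
        vector_add_component scaleR_conv_of_real[where 'a = complex] qq)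
  ultimately show ?thesis
    by (simp add: vec_eq_iff sumS c_def cov_def sum.distrib distrib_left)
qed

end

end

end

theory Submission
  imports Defs
begin

text \<open>
  Split the pilot observation of base station \<open>r\<close> as \<open>z = q g + y\<close>, where \<open>g\<close> is the channel of the
  user under consideration and \<open>y\<close> collects the other users of the pilot and the noise. Then \<open>y\<close>
  is centred and independent of \<open>g\<close>, so \<open>E|z\<^sup>H g|\<^sup>2\<close> reduces to \<open>q\<^sup>2 E\<parallel>g\<parallel>\<^sup>4\<close> and a trace of
  second moments. The fourth moment of \<open>\<parallel>g\<parallel>\<close> follows from
  \<open>E|x\<^sub>i|\<^sup>2|x\<^sub>j|\<^sup>2 = R\<^sub>i\<^sub>i R\<^sub>j\<^sub>j + |R\<^sub>i\<^sub>j|\<^sup>2\<close> for the scattering part \<open>x\<close>, all terms with an unbalanced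
  power of the random phase being zero. Signals at different base stations are independent, which
  gives the off-diagonal entries.
\<close>

section \<open>Calculus of square-integrable and fourth-power-integrable functions\<close>

lemma sq_int_cnj: "sq_int M f \<Longrightarrow> sq_int M (\<lambda>w. cnj (f w))"
  unfolding sq_int_def by (auto intro: measurable_compose[OF _ measurable_cnj])

lemma sq_int_cmult: "sq_int M f \<Longrightarrow> sq_int M (\<lambda>w. c * f w)"
  unfolding sq_int_def by (auto simp: norm_mult power_mult_distrib)

lemma sq_int_add:
  assumes "sq_int M f" "sq_int M h"
  shows "sq_int M (\<lambda>w. f w + h w)"
proof -
  have [measurable]: "f \<in> borel_measurable M" "h \<in> borel_measurable M"
    using assms by (auto simp: sq_int_def)
  have "integrable M (\<lambda>w. (cmod (f w + h w))\<^sup>2)"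
  proof (rule Bochner_Integration.integrable_bound)
    show "integrable M (\<lambda>w. 2 * (cmod (f w))\<^sup>2 + 2 * (cmod (h w))\<^sup>2)"
      using assms by (auto simp: sq_int_def)
    have "(cmod (f w + h w))\<^sup>2 \<le> 2 * (cmod (f w))\<^sup>2 + 2 * (cmod (h w))\<^sup>2" for w
    proof -
      have "(cmod (f w + h w))\<^sup>2 \<le> (cmod (f w) + cmod (h w))\<^sup>2"
        by (intro power_mono norm_triangle_ineq) auto
      also have "\<dots> \<le> 2 * (cmod (f w))\<^sup>2 + 2 * (cmod (h w))\<^sup>2"
        using sum_squares_bound[of "cmod (f w)" "cmod (h w)"] by (simp add: power2_sum)
      finally show ?thesis .
    qed
    then show "AE w in M. norm ((cmod (f w + h w))\<^sup>2)
        \<le> norm (2 * (cmod (f w))\<^sup>2 + 2 * (cmod (h w))\<^sup>2)" by simp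
  qed measurable
  then show ?thesis by (simp add: sq_int_def)
qed

lemma sq_int_zero: "sq_int M (\<lambda>w. 0)"
  by (simp add: sq_int_def)

lemma sq_int_sum: "(\<And>i. i \<in> I \<Longrightarrow> sq_int M (f i)) \<Longrightarrow> sq_int M (\<lambda>w. \<Sum>i\<in>I. f i w)"
  by (induction I rule: infinite_finite_induct) (auto intro: sq_int_add sq_int_zero)

lemma sq_int_mult_integrable:
  assumes "sq_int M f" "sq_int M h"
  shows "integrable M (\<lambda>w. f w * h w)"
  using sq_int_mult[OF assms(1) sq_int_cnj[OF assms(2)]] by simp

text \<open>Finiteness of E|f|^4, phrased as square integrability of the square so that the closure
  rules for \<open>sq_int\<close> can be reused. Measurability of \<open>f\<close> is a separate
  conjunct because measurability of the square does not imply it.\<close>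

definition fourth_int :: "'w measure \<Rightarrow> ('w \<Rightarrow> complex) \<Rightarrow> bool" where
  "fourth_int M f \<longleftrightarrow> f \<in> borel_measurable M \<and> sq_int M (\<lambda>w. f w * f w)"

text \<open>Domination by AM-GM: 2 |f|^2 |h|^2 <= |f|^4 + |h|^4. Products of two entries are thus
  square integrable, and products of four are integrable.\<close>

lemma fourth_int_mult:
  assumes "fourth_int M f" "fourth_int M h"
  shows "sq_int M (\<lambda>w. f w * h w)"
proof -
  have [measurable]: "f \<in> borel_measurable M" "h \<in> borel_measurable M"
    using assms by (auto simp: fourth_int_def)
  have "integrable M (\<lambda>w. (cmod (f w * h w))\<^sup>2)"
  proof (rule Bochner_Integration.integrable_bound)
    show "integrable M (\<lambda>w. (cmod (f w * f w))\<^sup>2 + (cmod (h w * h w))\<^sup>2)"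
      using assms by (auto simp: fourth_int_def sq_int_def)
    have "(a * b)\<^sup>2 \<le> (a * a)\<^sup>2 + (b * b)\<^sup>2" for a b :: real
    proof -
      have "2 * (a * b)\<^sup>2 \<le> (a * a)\<^sup>2 + (b * b)\<^sup>2"
        using sum_squares_bound[of "a * a" "b * b"] by (simp add: power2_eq_square ac_simps)
      then show ?thesis using zero_le_power2[of "a * b"] by linarith
    qed
    then show "AE w in M. norm ((cmod (f w * h w))\<^sup>2)
        \<le> norm ((cmod (f w * f w))\<^sup>2 + (cmod (h w * h w))\<^sup>2)"
      by (simp add: norm_mult)
  qed measurable
  then show ?thesis by (simp add: sq_int_def)
qed

lemma fourth_int_cnj: "fourth_int M f \<Longrightarrow> fourth_int M (\<lambda>w. cnj (f w))"
  unfolding fourth_int_def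
  by (auto intro: measurable_compose[OF _ measurable_cnj] dest: sq_int_cnj)

lemma fourth_int_cmult: "fourth_int M f \<Longrightarrow> fourth_int M (\<lambda>w. c * f w)"
  unfolding fourth_int_def using sq_int_cmult[of M "\<lambda>w. f w * f w" "c * c"]
  by (auto simp: ac_simps)

text \<open>The square of the sum is expanded, and the mixed term is square integrable by
  \<open>fourth_int_mult\<close>.\<close>

lemma fourth_int_add:
  assumes "fourth_int M f" "fourth_int M h"
  shows "fourth_int M (\<lambda>w. f w + h w)"
proof -
  have "sq_int M (\<lambda>w. f w * f w + 2 * (f w * h w) + h w * h w)"
    by (intro sq_int_add sq_int_cmult fourth_int_mult assms)
  then show ?thesis using assms by (auto simp: fourth_int_def algebra_simps)
qed

lemma fourth_int_sum:
  "(\<And>i. i \<in> I \<Longrightarrow> fourth_int M (f i)) \<Longrightarrow> fourth_int M (\<lambda>w. \<Sum>i\<in>I. f i w)"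
proof (induction I rule: infinite_finite_induct)
  case (insert i I)
  then show ?case by (auto intro: fourth_int_add)
qed (auto simp: fourth_int_def sq_int_zero)

text \<open>On a probability space the constant 1 is itself \<open>fourth_int\<close>, so the
  product rule with second factor 1 lowers the exponent from four to two.\<close>

lemma (in prob_space) fourth_int_sq_int:
  assumes "fourth_int M f"
  shows "sq_int M f"
proof -
  have "fourth_int M (\<lambda>_. 1)" by (simp add: fourth_int_def sq_int_def)
  from fourth_int_mult[OF assms this] show ?thesis by simp
qed

text \<open>Used for integrability of the fourth-order moments: once inner products of channels and
  pilots are square integrable, products of two of them have an expectation.\<close>

lemma sq_int_hdot:
  assumes "\<And>i. fourth_int M (\<lambda>w. X w $ i)" "\<And>i. fourth_int M (\<lambda>w. Y w $ i)"
  shows "sq_int M (\<lambda>w. hdot (X w) (Y w))"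
  unfolding hdot_def by (intro sq_int_sum fourth_int_mult fourth_int_cnj assms)

section \<open>Entrywise integration of vectors and matrices\<close>

lemma integrable_vecI:
  fixes f :: "'a \<Rightarrow> 'b::euclidean_space ^ 'n"
  assumes "\<And>i. integrable M (\<lambda>w. f w $ i)"
  shows "integrable M f"
proof -
  have "integrable M (\<lambda>w. \<Sum>b\<in>Basis. (f w \<bullet> b) *\<^sub>R b)"
  proof (intro Bochner_Integration.integrable_sum integrable_scaleR_left)
    fix b :: "'b ^ 'n" assume "b \<in> Basis"
    then obtain i c where b: "b = axis i c" by (auto simp: Basis_vec_def)
    show "integrable M (\<lambda>w. f w \<bullet> b)"
      using integrable_inner_left[OF assms[of i], of c] by (simp add: b inner_axis)
  qed
  then show ?thesis by (simp add: euclidean_representation)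
qed

lemma integral_vec_nth:
  fixes f :: "'a \<Rightarrow> 'b::euclidean_space ^ 'n"
  assumes "\<And>i. integrable M (\<lambda>w. f w $ i)"
  shows "(\<integral>w. f w \<partial>M) $ i = (\<integral>w. f w $ i \<partial>M)"
  using integral_bounded_linear[OF bounded_linear_vec_nth integrable_vecI[OF assms]] by simp

lemma second_moment_nth:
  assumes "\<And>i. sq_int M (\<lambda>w. X w $ i)"
  shows "second_moment M X $ i $ j = (\<integral>w. X w $ i * cnj (X w $ j) \<partial>M)"
proof -
  have 1: "integrable M (\<lambda>w. outer (X w) (X w) $ i $ j)" for i j
    by (simp add: outer_def sq_int_mult assms)
  \<comment> \<open>An entry of the matrix integral is extracted in two stages, row and then column,
    and each stage needs integrability at its own level.\<close>
  then have "integrable M (\<lambda>w. outer (X w) (X w) $ i)" for i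
    by (rule integrable_vecI)
  with 1 show ?thesis
    unfolding second_moment_def by (simp add: integral_vec_nth) (simp add: outer_def)
qed

section \<open>Fourth moments of Gaussian vectors\<close>

text \<open>A centred normal variable has kurtosis 3. Since \<open>real_gaussian\<close> also admits
  almost surely constant variables, there is a degenerate case: mean zero forces the constant to be
  0, and both sides vanish.\<close>

lemma (in prob_space) real_gaussian_centered_fourth_moment:
  assumes X: "real_gaussian M X" and mean: "(\<integral>w. X w \<partial>M) = 0"
  shows "integrable M (\<lambda>w. X w ^ 4)" "(\<integral>w. X w ^ 4 \<partial>M) = 3 * (\<integral>w. (X w)\<^sup>2 \<partial>M)\<^sup>2"
proof -
  have [measurable]: "X \<in> borel_measurable M" using X by (simp add: real_gaussian_def)
  consider \<mu> s where "0 < s" "distributed M lborel X (normal_density \<mu> s)"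
    | \<mu> where "AE w in M. X w = \<mu>"
    using X by (auto simp: real_gaussian_def)
  then have "integrable M (\<lambda>w. X w ^ 4) \<and> (\<integral>w. X w ^ 4 \<partial>M) = 3 * (\<integral>w. (X w)\<^sup>2 \<partial>M)\<^sup>2"
  proof cases
    case 1
    have [simp]: "\<mu> = 0"
      using normal_distributed_expectation[OF 1] mean by simp
    have i: "(\<integral>w. X w ^ n \<partial>M) = (\<integral>x. normal_density 0 s x * x ^ n \<partial>lborel)" for n
      using distributed_integral[OF 1(2), of "\<lambda>x. x ^ n"] by simp
    have "integrable M (\<lambda>w. X w ^ 4)"
      using distributed_integrable[OF 1(2), of "\<lambda>x. x ^ 4"] integrable_normal_moment[OF 1(1), of 0 4]
      by simp
    moreover have "(\<integral>w. (X w)\<^sup>2 \<partial>M) = s\<^sup>2"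
      using integral_normal_moment_even[OF 1(1), of 0 1] by (simp add: i)
    \<comment> \<open>The centred moment of order 2k is (2k)! s^(2k) / (2^k k!), which gives the
      factor 3 at k = 2.\<close>
    moreover have "(\<integral>w. X w ^ 4 \<partial>M) = 3 * (s\<^sup>2)\<^sup>2"
      using integral_normal_moment_even[OF 1(1), of 0 2] 1(1)
      by (simp add: i fact_numeral power2_eq_square field_simps)
    ultimately show ?thesis by simp
  next
    case 2
    have "(\<integral>w. X w \<partial>M) = (\<integral>w. \<mu> \<partial>M)"
      using 2 by (intro integral_cong_AE) auto
    with mean have [simp]: "\<mu> = 0" by (simp add: prob_space)
    have "integrable M (\<lambda>w. X w ^ 4) \<longleftrightarrow> integrable M (\<lambda>w. 0 :: real)"
      using 2 by (intro integrable_cong_AE) auto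
    moreover have "(\<integral>w. X w ^ n \<partial>M) = (\<integral>w. 0 \<partial>M)" if "n > 0" for n
      using 2 that by (intro integral_cong_AE) auto
    ultimately show ?thesis by simp
  qed
  then show "integrable M (\<lambda>w. X w ^ 4)" "(\<integral>w. X w ^ 4 \<partial>M) = 3 * (\<integral>w. (X w)\<^sup>2 \<partial>M)\<^sup>2" by auto
qed

text \<open>Isserlis' formula \<open>E X\<^sup>2 Y\<^sup>2 = E X\<^sup>2 E Y\<^sup>2 + 2 (E X Y)\<^sup>2\<close> follows from the one-dimensional
  fourth moments by polarization, so no joint density is needed.\<close>

lemma (in prob_space) jointly_gaussian_fourth_moment:
  fixes X Y :: "'a \<Rightarrow> real"
  assumes X: "real_gaussian M X" and Y: "real_gaussian M Y"
    and S: "real_gaussian M (\<lambda>w. X w + Y w)" and D: "real_gaussian M (\<lambda>w. X w - Y w)"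
    and mX: "(\<integral>w. X w \<partial>M) = 0" and mY: "(\<integral>w. Y w \<partial>M) = 0"
  shows "integrable M (\<lambda>w. X w * Y w)" "integrable M (\<lambda>w. (X w)\<^sup>2 * (Y w)\<^sup>2)"
    "(\<integral>w. (X w)\<^sup>2 * (Y w)\<^sup>2 \<partial>M)
      = (\<integral>w. (X w)\<^sup>2 \<partial>M) * (\<integral>w. (Y w)\<^sup>2 \<partial>M) + 2 * (\<integral>w. X w * Y w \<partial>M)\<^sup>2"
proof -
  have int: "integrable M Z" if "real_gaussian M Z" for Z
  proof (rule square_integrable_imp_integrable)
    show "Z \<in> borel_measurable M" using that by (simp add: real_gaussian_def)
  qed (rule real_gaussian_sq_integrable[OF that])
  note sq = real_gaussian_sq_integrable[OF X] real_gaussian_sq_integrable[OF Y]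
    real_gaussian_sq_integrable[OF S] real_gaussian_sq_integrable[OF D]
  have mS: "(\<integral>w. X w + Y w \<partial>M) = 0" "(\<integral>w. X w - Y w \<partial>M) = 0"
    using int[OF X] int[OF Y] mX mY by simp_all
  note q = real_gaussian_centered_fourth_moment[OF X mX] real_gaussian_centered_fourth_moment[OF Y mY]
    real_gaussian_centered_fourth_moment[OF S mS(1)] real_gaussian_centered_fourth_moment[OF D mS(2)]
  have eq1: "X w * Y w = ((X w + Y w)\<^sup>2 - (X w - Y w)\<^sup>2) / 4" for w
    by (simp add: power2_eq_square algebra_simps)
  show XY: "integrable M (\<lambda>w. X w * Y w)"
    unfolding eq1 using sq by simp
  \<comment> \<open>Odd powers cancel between the two binomial expansions, whose sum is 2 X^4 + 12
    X^2 Y^2 + 2 Y^4; hence the 12.\<close>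
  have eq2: "(X w)\<^sup>2 * (Y w)\<^sup>2 = ((X w + Y w) ^ 4 + (X w - Y w) ^ 4 - 2 * X w ^ 4 - 2 * Y w ^ 4) / 12" for w
    by (simp add: power2_eq_square power4_eq_xxxx algebra_simps)
  show "integrable M (\<lambda>w. (X w)\<^sup>2 * (Y w)\<^sup>2)"
    unfolding eq2 using q by simp
  define p s c where "p = (\<integral>w. (X w)\<^sup>2 \<partial>M)" and "s = (\<integral>w. (Y w)\<^sup>2 \<partial>M)" and "c = (\<integral>w. X w * Y w \<partial>M)"
  have "(\<integral>w. (X w + Y w)\<^sup>2 \<partial>M) = p + s + 2 * c" "(\<integral>w. (X w - Y w)\<^sup>2 \<partial>M) = p + s - 2 * c"
    using sq XY by (simp_all add: power2_sum power2_diff p_def s_def c_def mult.assoc)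
  then have "(\<integral>w. (X w)\<^sup>2 * (Y w)\<^sup>2 \<partial>M)
      = (3 * (p + s + 2 * c)\<^sup>2 + 3 * (p + s - 2 * c)\<^sup>2 - 2 * (3 * p\<^sup>2) - 2 * (3 * s\<^sup>2)) / 12"
    unfolding eq2 using q by (simp add: p_def s_def)
  also have "\<dots> = p * s + 2 * c\<^sup>2"
    by (simp add: power2_eq_square algebra_simps)
  finally show "(\<integral>w. (X w)\<^sup>2 * (Y w)\<^sup>2 \<partial>M)
      = (\<integral>w. (X w)\<^sup>2 \<partial>M) * (\<integral>w. (Y w)\<^sup>2 \<partial>M) + 2 * (\<integral>w. X w * Y w \<partial>M)\<^sup>2"
    by (simp add: p_def s_def c_def)
qed

context prob_space
begin

context
  fixes X :: "'a \<Rightarrow> complex ^ 'm" and R :: "complex ^ 'm ^ 'm"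
  assumes X: "circ_gaussian M X R"
begin

lemma circ_gaussian_mean: "(\<integral>w. X w $ i \<partial>M) = 0"
proof -
  have "(\<integral>w. X w \<partial>M) $ i = (\<integral>w. X w $ i \<partial>M)"
    by (intro integral_vec_nth sq_int_integrable circ_gaussian_sq_int[OF X])
  with X show ?thesis by (simp add: circ_gaussian_def)
qed

lemma circ_gaussian_cov: "(\<integral>w. X w $ i * cnj (X w $ j) \<partial>M) = R $ i $ j"
proof -
  have "R = second_moment M X" using X by (simp add: circ_gaussian_def second_moment_def)
  then show ?thesis by (simp add: second_moment_nth circ_gaussian_sq_int[OF X])
qed

text \<open>Rotating by a quarter turn changes the sign of \<open>E X\<^sub>i X\<^sub>j\<close>.\<close>

lemma circ_gaussian_pseudo_cov: "(\<integral>w. X w $ i * X w $ j \<partial>M) = 0"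
proof -
  have [measurable]: "X \<in> borel_measurable M" using X by (simp add: circ_gaussian_def)
  have "continuous_on UNIV (\<lambda>v :: complex ^ 'm. \<i> *s v)"
    unfolding vector_scalar_mult_def by (intro continuous_intros)
  then have "(\<lambda>v :: complex ^ 'm. \<i> *s v) \<in> borel_measurable borel"
    by (rule borel_measurable_continuous_onI)
  then have [measurable]: "(\<lambda>w. \<i> *s X w) \<in> borel_measurable M"
    by measurable
  have "distr M borel (\<lambda>w. cis (pi / 2) *s X w) = distr M borel X"
    using X unfolding circ_gaussian_def by metis
  then have rot: "distr M borel X = distr M borel (\<lambda>w. \<i> *s X w)"
    by simp
  have [measurable]: "(\<lambda>v :: complex ^ 'm. v $ i * v $ j) \<in> borel_measurable borel"
    by (intro borel_measurable_continuous_onI continuous_intros)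
  have "(\<integral>w. X w $ i * X w $ j \<partial>M) = (\<integral>v. v $ i * v $ j \<partial>distr M borel X)"
    by (subst integral_distr) auto
  also note rot
  also have "(\<integral>v. v $ i * v $ j \<partial>distr M borel (\<lambda>w. \<i> *s X w)) = (\<integral>w. (\<i> * X w $ i) * (\<i> * X w $ j) \<partial>M)"
    by (subst integral_distr) auto
  also have "\<dots> = (\<integral>w. - (X w $ i * X w $ j) \<partial>M)"
    by (intro Bochner_Integration.integral_cong) (auto simp: algebra_simps)
  finally show ?thesis by simp
qed

lemma circ_gaussian_inner_mean: "(\<integral>w. v \<bullet> X w \<partial>M) = 0"
proof -
  have "integrable M X"
    by (intro integrable_vecI sq_int_integrable circ_gaussian_sq_int[OF X])
  then show ?thesis using X by (simp add: circ_gaussian_def)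
qed

text \<open>Joint Gaussianity enters here: the sum and difference of the functionals given by
  \<open>u\<close> and \<open>v\<close> are the functionals given by \<open>u + v\<close> and
  \<open>u - v\<close>, hence Gaussian again, as the polarization argument requires.\<close>

lemma circ_gaussian_inner_fourth_moment:
  "integrable M (\<lambda>w. (u \<bullet> X w) * (v \<bullet> X w))"
  "integrable M (\<lambda>w. (u \<bullet> X w)\<^sup>2 * (v \<bullet> X w)\<^sup>2)"
  "(\<integral>w. (u \<bullet> X w)\<^sup>2 * (v \<bullet> X w)\<^sup>2 \<partial>M) =
    (\<integral>w. (u \<bullet> X w)\<^sup>2 \<partial>M) * (\<integral>w. (v \<bullet> X w)\<^sup>2 \<partial>M) + 2 * (\<integral>w. (u \<bullet> X w) * (v \<bullet> X w) \<partial>M)\<^sup>2"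
proof -
  have G: "real_gaussian M (\<lambda>w. v \<bullet> X w)" for v using X by (simp add: circ_gaussian_def)
  note * = jointly_gaussian_fourth_moment[OF G G
      G[of "u + v", unfolded inner_add_left] G[of "u - v", unfolded inner_diff_left]
      circ_gaussian_inner_mean circ_gaussian_inner_mean]
  show "integrable M (\<lambda>w. (u \<bullet> X w) * (v \<bullet> X w))" by (rule *(1))
  show "integrable M (\<lambda>w. (u \<bullet> X w)\<^sup>2 * (v \<bullet> X w)\<^sup>2)" by (rule *(2))
  show "(\<integral>w. (u \<bullet> X w)\<^sup>2 * (v \<bullet> X w)\<^sup>2 \<partial>M) =
    (\<integral>w. (u \<bullet> X w)\<^sup>2 \<partial>M) * (\<integral>w. (v \<bullet> X w)\<^sup>2 \<partial>M) + 2 * (\<integral>w. (u \<bullet> X w) * (v \<bullet> X w) \<partial>M)\<^sup>2"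
    by (rule *(3))
qed

text \<open>Pairing with \<open>axis i 1\<close> and \<open>axis i \<i>\<close> yields the real and
  imaginary part of the entry, so |X_i|^4 is a sum of products of squares of real Gaussians.\<close>

lemma circ_gaussian_fourth_int: "fourth_int M (\<lambda>w. X w $ i)"
proof -
  have [measurable]: "X \<in> borel_measurable M" using X by (simp add: circ_gaussian_def)
  let ?a = "\<lambda>w. axis i 1 \<bullet> X w" and ?b = "\<lambda>w. axis i \<i> \<bullet> X w"
  have eq: "(cmod (X w $ i * X w $ i))\<^sup>2
      = (?a w)\<^sup>2 * (?a w)\<^sup>2 + 2 * ((?a w)\<^sup>2 * (?b w)\<^sup>2) + (?b w)\<^sup>2 * (?b w)\<^sup>2" for w
  proof -
    have "(cmod (X w $ i * X w $ i))\<^sup>2 = ((cmod (X w $ i))\<^sup>2)\<^sup>2"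
      by (simp add: norm_mult power2_eq_square)
    also have "\<dots> = ((?a w)\<^sup>2 + (?b w)\<^sup>2)\<^sup>2"
      by (simp add: inner_axis' inner_complex_def cmod_power2)
    finally show ?thesis by (simp add: power2_eq_square algebra_simps)
  qed
  have "integrable M (\<lambda>w. (cmod (X w $ i * X w $ i))\<^sup>2)"
    unfolding eq by (intro Bochner_Integration.integrable_add integrable_mult_right
        circ_gaussian_inner_fourth_moment(2))
  then show ?thesis by (simp add: fourth_int_def sq_int_def)
qed

text \<open>Complex Wick formula: only pairings of an entry with a conjugated entry survive, since
  the pseudo-covariance vanishes. The real formula is applied to the four products of squared real
  and imaginary parts, and the result is reassembled.\<close>

lemma circ_gaussian_fourth_moment:
  "(\<integral>w. X w $ i * cnj (X w $ i) * (X w $ j * cnj (X w $ j)) \<partial>M)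
    = R $ i $ i * R $ j $ j + R $ i $ j * R $ j $ i"
proof -
  define e where "e u v = (\<integral>w. (u \<bullet> X w) * (v \<bullet> X w) \<partial>M)" for u v
  let ?a = "axis i 1" and ?b = "axis i \<i>" and ?c = "axis j 1" and ?d = "axis j \<i>"
  note int = circ_gaussian_inner_fourth_moment(1)
  have Xn: "X w $ n = complex_of_real (axis n 1 \<bullet> X w) + \<i> * complex_of_real (axis n \<i> \<bullet> X w)" for w n
    by (simp add: inner_axis' inner_complex_def complex_eq_iff)
  have cov: "R $ n $ p
      = complex_of_real (e (axis n 1) (axis p 1) + e (axis n \<i>) (axis p \<i>))
      + \<i> * complex_of_real (e (axis n \<i>) (axis p 1) - e (axis n 1) (axis p \<i>))" for n p
  proof -
    have "X w $ n * cnj (X w $ p)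
        = complex_of_real ((axis n 1 \<bullet> X w) * (axis p 1 \<bullet> X w) + (axis n \<i> \<bullet> X w) * (axis p \<i> \<bullet> X w))
        + \<i> * complex_of_real ((axis n \<i> \<bullet> X w) * (axis p 1 \<bullet> X w) - (axis n 1 \<bullet> X w) * (axis p \<i> \<bullet> X w))" for w
      by (simp add: Xn[of w n] Xn[of w p] complex_eq_iff del: inner_axis)
    then show ?thesis
      unfolding circ_gaussian_cov[symmetric] e_def using int
      by (simp del: of_real_add of_real_diff of_real_mult)
  qed
  \<comment> \<open>Real and imaginary part of E X_i X_j = 0. These relations reduce the four
    squared covariances below to two.\<close>
  have pseudo: "e ?a ?c = e ?b ?d \<and> e ?b ?c = - e ?a ?d"
  proof -
    have "X w $ i * X w $ j
        = complex_of_real ((?a \<bullet> X w) * (?c \<bullet> X w) - (?b \<bullet> X w) * (?d \<bullet> X w))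
        + \<i> * complex_of_real ((?b \<bullet> X w) * (?c \<bullet> X w) + (?a \<bullet> X w) * (?d \<bullet> X w))" for w
      by (simp add: Xn[of w i] Xn[of w j] complex_eq_iff)
    then have "(\<integral>w. X w $ i * X w $ j \<partial>M)
        = complex_of_real (e ?a ?c - e ?b ?d) + \<i> * complex_of_real (e ?b ?c + e ?a ?d)"
      unfolding e_def using int by (simp del: of_real_add of_real_diff of_real_mult)
    then show ?thesis by (simp add: circ_gaussian_pseudo_cov complex_eq_iff)
  qed
  have comm: "e u v = e v u" for u v by (simp add: e_def mult.commute)
  have fourth: "(\<integral>w. (u \<bullet> X w)\<^sup>2 * (v \<bullet> X w)\<^sup>2 \<partial>M) = e u u * e v v + 2 * (e u v)\<^sup>2" for u v
    unfolding circ_gaussian_inner_fourth_moment(3) e_def by (simp add: power2_eq_square)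
  have "X w $ i * cnj (X w $ i) * (X w $ j * cnj (X w $ j))
      = complex_of_real ((?a \<bullet> X w)\<^sup>2 * (?c \<bullet> X w)\<^sup>2 + (?a \<bullet> X w)\<^sup>2 * (?d \<bullet> X w)\<^sup>2
        + (?b \<bullet> X w)\<^sup>2 * (?c \<bullet> X w)\<^sup>2 + (?b \<bullet> X w)\<^sup>2 * (?d \<bullet> X w)\<^sup>2)" for w
    by (simp add: Xn[of w i] Xn[of w j] complex_eq_iff power2_eq_square algebra_simps)
  then have "(\<integral>w. X w $ i * cnj (X w $ i) * (X w $ j * cnj (X w $ j)) \<partial>M)
      = complex_of_real ((e ?a ?a + e ?b ?b) * (e ?c ?c + e ?d ?d)
        + 2 * ((e ?a ?c)\<^sup>2 + (e ?a ?d)\<^sup>2 + (e ?b ?c)\<^sup>2 + (e ?b ?d)\<^sup>2))"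
    using circ_gaussian_inner_fourth_moment(2)
    by (simp add: fourth algebra_simps del: of_real_add of_real_diff of_real_mult)
  also have "\<dots> = R $ i $ i * R $ j $ j + R $ i $ j * R $ j $ i"
  proof -
    have "R $ n $ n = complex_of_real (e (axis n 1) (axis n 1) + e (axis n \<i>) (axis n \<i>))" for n
      by (simp add: cov comm[of "axis n 1" "axis n \<i>"])
    \<comment> \<open>The entries (i,j) and (j,i) are conjugate, so their product is 4 (e ?b ?d)^2 +
      4 (e ?a ?d)^2. By \<open>pseudo\<close> this is twice the sum of the four squared
      covariances.\<close>
    moreover have "R $ i $ j = 2 * complex_of_real (e ?b ?d) - 2 * \<i> * complex_of_real (e ?a ?d)"
      by (simp add: cov pseudo algebra_simps)
    moreover have "R $ j $ i = 2 * complex_of_real (e ?b ?d) + 2 * \<i> * complex_of_real (e ?a ?d)"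
      by (simp add: cov pseudo comm[of ?c] comm[of ?d] algebra_simps)
    ultimately show ?thesis
      by (simp only: pseudo) (simp add: power2_eq_square algebra_simps)
  qed
  finally show ?thesis .
qed

end

end

section \<open>The cellular system\<close>

lemma hdot_measurable:
  assumes "\<And>i. (\<lambda>w. X w $ i) \<in> borel_measurable N" "\<And>i. (\<lambda>w. Y w $ i) \<in> borel_measurable N"
  shows "(\<lambda>w. hdot (X w) (Y w)) \<in> borel_measurable N"
  unfolding hdot_def
  by (intro borel_measurable_sum borel_measurable_times measurable_compose[OF _ measurable_cnj] assms)

lemma cnj_hdot: "cnj (hdot x y) = hdot y x"
  by (simp add: hdot_def mult.commute)

lemma Int_stable_vimage_borel: "Int_stable {X -` A \<inter> S |A. A \<in> sets borel}"
proof (rule Int_stableI, clarify)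
  fix A B :: "'b set" assume "A \<in> sets borel" "B \<in> sets borel"
  then show "\<exists>C. X -` A \<inter> S \<inter> (X -` B \<inter> S) = X -` C \<inter> S \<and> C \<in> sets borel"
    by (intro exI[of _ "A \<inter> B"]) auto
qed

text \<open>Intersection stability allows independence to pass from these families of events to the
  sigma-algebras that they generate.\<close>

lemma Int_stable_source_events: "Int_stable (source_events M \<theta> gt nn s)"
  by (cases s) (simp_all add: source_events_def Int_stable_vimage_borel)

lemma source_events_subset: "source_events M \<theta> gt nn s \<subseteq> Pow (space M)"
  by (cases s) (auto simp: source_events_def)

locale cellular_system = prob_space M for M :: "'w measure" +
  fixes \<theta> :: "'l::finite \<Rightarrow> 'k::finite \<Rightarrow> 'l \<Rightarrow> 'w \<Rightarrow> real"
    and gbar :: "'l \<Rightarrow> 'k \<Rightarrow> 'l \<Rightarrow> complex ^ 'm::finite"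
    and gt :: "'l \<Rightarrow> 'k \<Rightarrow> 'l \<Rightarrow> 'w \<Rightarrow> complex ^ 'm"
    and nn :: "'l \<Rightarrow> 'k \<Rightarrow> 'w \<Rightarrow> complex ^ 'm"
    and R :: "'l \<Rightarrow> 'k \<Rightarrow> 'l \<Rightarrow> complex ^ 'm ^ 'm"
    and \<sigma> :: real
    and \<tau>p :: nat and \<eta> :: real
  assumes phase: "\<And>l k r. distributed M lborel (\<theta> l k r)
            (\<lambda>t. indicator {0..<2 * pi} t / (2 * pi))"
    and scatter: "\<And>l k r. circ_gaussian M (gt l k r) (R l k r)"
    and noise: "\<And>l k. circ_gaussian M (nn l k) (mat (complex_of_real (\<sigma>\<^sup>2)))"
    and ind: "indep_sets (source_events M \<theta> gt nn) UNIV"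
    and power_pos: "0 < \<eta>"
begin

abbreviation g where "g \<equiv> channel \<theta> gbar gt"
abbreviation z where "z \<equiv> pilot_obs \<tau>p \<eta> g nn"

section \<open>Sigma-algebras generated by groups of sources\<close>

definition sources :: "('l, 'k) source set \<Rightarrow> 'w measure" where
  "sources A = sigma (space M) (\<Union>s\<in>A. source_events M \<theta> gt nn s)"

lemma space_sources [simp]: "space (sources A) = space M"
  unfolding sources_def by (rule space_measure_of) (use source_events_subset in blast)

lemma sets_sources: "sets (sources A) = sigma_sets (space M) (\<Union>s\<in>A. source_events M \<theta> gt nn s)"
  unfolding sources_def by (rule sets_measure_of) (use source_events_subset in blast)

text \<open>Disjoint groups of independent sources generate independent sigma-algebras, so any two
  variables measurable with respect to such groups are independent. The factorizations below all
  arise by naming two disjoint sets of sources.\<close>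

lemma expectation_mult_indep:
  fixes X Y :: "'w \<Rightarrow> complex"
  assumes "A \<inter> B = {}"
    and X: "X \<in> borel_measurable (sources A)" and Y: "Y \<in> borel_measurable (sources B)"
    and int: "integrable M X" "integrable M Y"
  shows "(\<integral>w. X w * Y w \<partial>M) = (\<integral>w. X w \<partial>M) * (\<integral>w. Y w \<partial>M)"
proof -
  \<comment> \<open>The two groups form a family over \<open>bool\<close>, the index type used by
    \<open>indep_set\<close>.\<close>
  let ?I = "case_bool A B"
  let ?F = "\<lambda>X. {X -` S \<inter> space M |S. S \<in> sets (borel :: complex measure)}"
  have "indep_sets (\<lambda>j. sigma_sets (space M) (\<Union>s\<in>?I j. source_events M \<theta> gt nn s)) UNIV"
  proof (rule indep_sets_collect_sigma)
    show "indep_sets (source_events M \<theta> gt nn) (\<Union>j\<in>UNIV. ?I j)"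
      using ind by (rule indep_sets_mono_index[rotated]) auto
    show "disjoint_family_on ?I UNIV"
      using assms(1) by (auto simp: disjoint_family_on_def split: bool.splits)
  qed (rule Int_stable_source_events)
  then have "indep_sets (\<lambda>j. sets (sources (?I j))) UNIV"
    by (simp add: sets_sources)
  moreover
  have F: "sigma_sets (space M) (?F X) \<subseteq> sets (sources C)"
    if "X \<in> borel_measurable (sources C)" for X C
    using sets.sigma_sets_subset[of "?F X" "sources C"] measurable_sets[OF that] by auto
  ultimately have "indep_set (sigma_sets (space M) (?F X)) (sigma_sets (space M) (?F Y))"
    unfolding indep_set_def
    using F[OF X] F[OF Y] by (elim indep_sets_mono_sets) (auto split: bool.splits)
  then have "indep_var borel X borel Y"
    unfolding indep_var_eq using int by auto
  from indep_var_lebesgue_integral[OF this int] show ?thesis .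
qed

lemma source_event_in_sources:
  "s \<in> A \<Longrightarrow> E \<in> source_events M \<theta> gt nn s \<Longrightarrow> E \<in> sets (sources A)"
  by (auto simp: sets_sources)

lemma phase_measurable_sources:
  assumes "Phase l k r \<in> A" shows "\<theta> l k r \<in> borel_measurable (sources A)"
  using source_event_in_sources[OF assms] by (intro measurableI) (auto simp: source_events_def)

lemma scatter_measurable_sources:
  assumes "Scatter l k r \<in> A" shows "(\<lambda>w. gt l k r w $ i) \<in> borel_measurable (sources A)"
  using source_event_in_sources[OF assms]
  by (intro measurable_nth measurableI) (auto simp: source_events_def)

lemma noise_measurable_sources:
  assumes "Noise l k \<in> A" shows "(\<lambda>w. nn l k w $ i) \<in> borel_measurable (sources A)"
  using source_event_in_sources[OF assms]
  by (intro measurable_nth measurableI) (auto simp: source_events_def)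

lemma channel_nth: "g l k r w $ i = cis (\<theta> l k r w) * gbar l k r $ i + gt l k r w $ i"
  by (simp add: channel_def)

definition channel_sources :: "'l \<Rightarrow> 'k \<Rightarrow> 'l \<Rightarrow> ('l, 'k) source set" where
  "channel_sources l k r = {Phase l k r, Scatter l k r}"

text \<open>Only sources with base station \<open>r\<close> and pilot index \<open>k\<close> occur,
  so the sets for two base stations, or for two pilots, are disjoint.\<close>

definition pilot_sources :: "'l \<Rightarrow> 'k \<Rightarrow> ('l, 'k) source set" where
  "pilot_sources r k = (\<Union>l. channel_sources l k r) \<union> {Noise r k}"

lemma channel_measurable_sources:
  assumes "channel_sources l k r \<subseteq> A"
  shows "(\<lambda>w. g l k r w $ i) \<in> borel_measurable (sources A)"
proof -
  have "\<theta> l k r \<in> borel_measurable (sources A)" "(\<lambda>w. gt l k r w $ i) \<in> borel_measurable (sources A)"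
    using assms by (auto simp: channel_sources_def intro: phase_measurable_sources scatter_measurable_sources)
  then show ?thesis unfolding channel_nth
    by (intro borel_measurable_add borel_measurable_times measurable_compose[OF _ measurable_cis]) auto
qed

text \<open>The remainder y in z = q g + y. Subtraction makes the splitting immediate, while
  \<open>interference_nth\<close> shows that y involves only the other cells and the noise.\<close>

definition interference :: "'l \<Rightarrow> 'k \<Rightarrow> 'l \<Rightarrow> 'w \<Rightarrow> complex ^ 'm" where
  "interference l k r w = z r k w - complex_of_real (sqrt (real \<tau>p * \<eta>)) *s g l k r w"

lemma interference_nth:
  "interference l k r w $ i
    = (\<Sum>l'\<in>UNIV - {l}. complex_of_real (sqrt (real \<tau>p * \<eta>)) * g l' k r w $ i) + nn r k w $ i"
  by (simp add: interference_def pilot_obs_def sum_distrib_left[symmetric] sum_diff1 algebra_simps)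

lemma pilot_nth:
  "z r k w $ i = complex_of_real (sqrt (real \<tau>p * \<eta>)) * g l k r w $ i + interference l k r w $ i"
  by (simp add: interference_def)

lemma interference_measurable_sources:
  assumes "pilot_sources r k - channel_sources l k r \<subseteq> A"
  shows "(\<lambda>w. interference l k r w $ i) \<in> borel_measurable (sources A)"
proof -
  have "channel_sources l' k r \<subseteq> A" if "l' \<noteq> l" for l'
    using assms that by (auto simp: pilot_sources_def channel_sources_def)
  moreover have "Noise r k \<in> A"
    using assms by (auto simp: pilot_sources_def channel_sources_def)
  ultimately show ?thesis unfolding interference_nth
    by (intro borel_measurable_add borel_measurable_sum borel_measurable_times
        channel_measurable_sources noise_measurable_sources) auto
qed

lemma pilot_measurable_sources:
  assumes "pilot_sources r k \<subseteq> A"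
  shows "(\<lambda>w. z r k w $ i) \<in> borel_measurable (sources A)"
proof -
  \<comment> \<open>The splitting of the pilot is available around every cell;
    \<open>undefined\<close> merely names one.\<close>
  have "(\<lambda>w. g undefined k r w $ i) \<in> borel_measurable (sources A)"
    "(\<lambda>w. interference undefined k r w $ i) \<in> borel_measurable (sources A)"
    using assms by (intro channel_measurable_sources interference_measurable_sources;
        auto simp: pilot_sources_def)+
  then show ?thesis unfolding pilot_nth[of r k _ i undefined]
    by (intro borel_measurable_add borel_measurable_times) auto
qed

lemma cis_phase_integrable: "integrable M (\<lambda>w. cis (\<theta> l k r w))"
proof (rule integrable_const_bound[where B = 1])
  have "\<theta> l k r \<in> borel_measurable M"
    using distributed_measurable[OF phase] by simp
  then show "(\<lambda>w. cis (\<theta> l k r w)) \<in> borel_measurable M"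
    by (intro measurable_compose[OF _ measurable_cis]) simp
qed simp

text \<open>Entries of the line-of-sight part have constant modulus and those of the scattering part
  are Gaussian, so both have fourth moments.\<close>

lemma channel_fourth_int: "fourth_int M (\<lambda>w. g l k r w $ i)"
proof -
  have [measurable]: "\<theta> l k r \<in> borel_measurable M"
    using distributed_measurable[OF phase] by simp
  have "(\<lambda>w. cis (\<theta> l k r w)) \<in> borel_measurable M"
    by (rule measurable_compose[OF _ measurable_cis]) simp
  then have "fourth_int M (\<lambda>w. cis (\<theta> l k r w))"
    by (auto simp: fourth_int_def sq_int_def norm_mult)
  from fourth_int_cmult[OF this, of "gbar l k r $ i"]
  show ?thesis unfolding channel_nth
    by (intro fourth_int_add circ_gaussian_fourth_int[OF scatter]) (simp add: mult.commute)
qed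

lemma interference_fourth_int: "fourth_int M (\<lambda>w. interference l k r w $ i)"
  unfolding interference_nth
  by (intro fourth_int_add fourth_int_sum fourth_int_cmult channel_fourth_int
      circ_gaussian_fourth_int[OF noise])

lemma pilot_fourth_int: "fourth_int M (\<lambda>w. z r k w $ i)"
  unfolding pilot_nth[of r k _ i undefined]
  by (intro fourth_int_add fourth_int_cmult channel_fourth_int interference_fourth_int)

lemmas channel_sq_int = fourth_int_sq_int[OF channel_fourth_int]
  and interference_sq_int = fourth_int_sq_int[OF interference_fourth_int]
  and pilot_sq_int = fourth_int_sq_int[OF pilot_fourth_int]

text \<open>The uniform phase averages the deterministic component away.\<close>

lemma channel_mean: "(\<integral>w. g l k r w $ i \<partial>M) = 0"
proof -
  have "integrable M (\<lambda>w. gt l k r w $ i)"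
    by (intro sq_int_integrable circ_gaussian_sq_int[OF scatter])
  then show ?thesis
    using cis_phase_integrable[of l k r]
    by (simp add: channel_nth integral_uniform_phase[OF phase] circ_gaussian_mean[OF scatter])
qed

lemma interference_mean: "(\<integral>w. interference l k r w $ i \<partial>M) = 0"
proof -
  have "integrable M (\<lambda>w. nn r k w $ i)"
    by (intro sq_int_integrable circ_gaussian_sq_int[OF noise])
  then show ?thesis
    by (simp add: interference_nth channel_mean circ_gaussian_mean[OF noise]
        sq_int_integrable channel_sq_int)
qed

lemma pilot_mean: "(\<integral>w. z r k w $ i \<partial>M) = 0"
  by (simp add: pilot_nth[of r k _ i undefined] channel_mean interference_mean
      sq_int_integrable channel_sq_int interference_sq_int)

section \<open>Inner products of independent vectors\<close>

lemma expectation_hdot_square_indep: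
  assumes AB: "A \<inter> B = {}"
    and X: "\<And>i. (\<lambda>w. X w $ i) \<in> borel_measurable (sources A)"
    and Y: "\<And>i. (\<lambda>w. Y w $ i) \<in> borel_measurable (sources B)"
    and X4: "\<And>i. fourth_int M (\<lambda>w. X w $ i)" and Y4: "\<And>i. fourth_int M (\<lambda>w. Y w $ i)"
  shows "(\<integral>w. hdot (X w) (Y w) * hdot (Y w) (X w) \<partial>M)
    = trace (second_moment M X ** second_moment M Y)"
proof -
  have eq: "hdot (X w) (Y w) * hdot (Y w) (X w)
      = (\<Sum>i\<in>UNIV. \<Sum>j\<in>UNIV. (X w $ j * cnj (X w $ i)) * (Y w $ i * cnj (Y w $ j)))" for w
    unfolding hdot_def sum_product by (simp add: mult_ac)
  have int: "integrable M (\<lambda>w. (X w $ j * cnj (X w $ i)) * (Y w $ i * cnj (Y w $ j)))" for i j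
    by (intro sq_int_mult_integrable fourth_int_mult fourth_int_cnj X4 Y4)
  \<comment> \<open>The expansion of |x^H y|^2 has been arranged so that each summand separates into
    an x-part and a y-part; these are entries (j,i) and (i,j) of the two second moments, and the
    double sum is a trace.\<close>
  have "(\<integral>w. (X w $ j * cnj (X w $ i)) * (Y w $ i * cnj (Y w $ j)) \<partial>M)
      = second_moment M X $ j $ i * second_moment M Y $ i $ j" for i j
    unfolding second_moment_nth[OF fourth_int_sq_int[OF X4]] second_moment_nth[OF fourth_int_sq_int[OF Y4]]
    by (intro expectation_mult_indep[OF AB] borel_measurable_times
        measurable_compose[OF _ measurable_cnj] X Y sq_int_mult fourth_int_sq_int X4 Y4)
  then have "(\<integral>w. hdot (X w) (Y w) * hdot (Y w) (X w) \<partial>M)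
      = (\<Sum>i\<in>UNIV. \<Sum>j\<in>UNIV. second_moment M X $ j $ i * second_moment M Y $ i $ j)"
    unfolding eq by (simp add: int)
  also have "\<dots> = trace (second_moment M X ** second_moment M Y)"
    unfolding trace_def matrix_matrix_mult_def by (simp) (rule sum.swap)
  finally show ?thesis .
qed

lemma expectation_hdot_indep:
  assumes AB: "A \<inter> B = {}"
    and X: "\<And>i. (\<lambda>w. X w $ i) \<in> borel_measurable (sources A)"
    and Y: "\<And>i. (\<lambda>w. Y w $ i) \<in> borel_measurable (sources B)"
    and X2: "\<And>i. sq_int M (\<lambda>w. X w $ i)" and Y2: "\<And>i. sq_int M (\<lambda>w. Y w $ i)"
    and mean: "\<And>i. (\<integral>w. X w $ i \<partial>M) = 0"
  shows "(\<integral>w. hdot (X w) (Y w) \<partial>M) = 0"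
proof -
  have "(\<integral>w. cnj (X w $ i) * Y w $ i \<partial>M) = 0" for i
    by (subst expectation_mult_indep[OF AB])
      (auto intro!: measurable_compose[OF _ measurable_cnj] X Y sq_int_integrable sq_int_cnj X2 Y2
        simp: mean)
  moreover have "integrable M (\<lambda>w. cnj (X w $ i) * Y w $ i)" for i
    by (intro sq_int_mult_integrable sq_int_cnj X2 Y2)
  ultimately show ?thesis unfolding hdot_def by simp
qed

end

section \<open>The SINR through quadratic forms\<close>

lemma expectation_cmod_sum_square:
  fixes H :: "'l::finite \<Rightarrow> 'w \<Rightarrow> complex"
  assumes "\<And>n. sq_int M (H n)"
  shows "complex_of_real (\<integral>x. (cmod (\<Sum>n\<in>UNIV. cnj (v $ n) * H n x))\<^sup>2 \<partial>M)
    = hdot v ((\<chi> r n. \<integral>x. H r x * cnj (H n x) \<partial>M) *v v)"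
proof -
  have eq: "complex_of_real ((cmod (\<Sum>n\<in>UNIV. cnj (v $ n) * H n x))\<^sup>2)
      = (\<Sum>r\<in>UNIV. \<Sum>n\<in>UNIV. cnj (v $ r) * v $ n * (H r x * cnj (H n x)))" for x
    unfolding complex_norm_square cnj_sum sum_product by (simp add: mult_ac)
  have "complex_of_real (\<integral>x. (cmod (\<Sum>n\<in>UNIV. cnj (v $ n) * H n x))\<^sup>2 \<partial>M)
      = (\<Sum>r\<in>UNIV. \<Sum>n\<in>UNIV. cnj (v $ r) * v $ n * (\<integral>x. H r x * cnj (H n x) \<partial>M))"
    unfolding integral_complex_of_real[symmetric] eq by (simp add: sq_int_mult assms)
  also have "\<dots> = hdot v ((\<chi> r n. \<integral>x. H r x * cnj (H n x) \<partial>M) *v v)"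
    by (simp add: hdot_def matrix_vector_mult_def sum_distrib_left mult_ac)
  finally show ?thesis .
qed

text \<open>The complex variance identity; it produces the subtracted |a^H b|^2 in the denominator
  of the SINR.\<close>

lemma (in prob_space) expectation_cmod_deviation_square:
  assumes "sq_int M F"
  shows "(\<integral>x. (cmod (F x - (\<integral>y. F y \<partial>M)))\<^sup>2 \<partial>M)
    = (\<integral>x. (cmod (F x))\<^sup>2 \<partial>M) - (cmod (\<integral>y. F y \<partial>M))\<^sup>2"
proof -
  define m where "m = (\<integral>y. F y \<partial>M)"
  have int: "integrable M F" "integrable M (\<lambda>x. F x * cnj (F x))"
    using assms by (auto intro: sq_int_integrable sq_int_mult)
  have eq: "complex_of_real ((cmod (F x - m))\<^sup>2)
      = F x * cnj (F x) - cnj m * F x - m * cnj (F x) + m * cnj m" for x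
    unfolding complex_norm_square by (simp add: algebra_simps)
  have "complex_of_real (\<integral>x. (cmod (F x - m))\<^sup>2 \<partial>M) = (\<integral>x. F x * cnj (F x) \<partial>M) - m * cnj m"
    unfolding integral_complex_of_real[symmetric] eq using int
    by (simp add: m_def[symmetric] prob_space)
  also have "\<dots> = complex_of_real ((\<integral>x. (cmod (F x))\<^sup>2 \<partial>M) - (cmod m)\<^sup>2)"
    unfolding of_real_diff integral_complex_of_real[symmetric] complex_norm_square ..
  finally show ?thesis unfolding m_def of_real_eq_iff .
qed

text \<open>The power of each weighted sum is a quadratic form of its weight vector. The
  \<open>BU\<close> term supplies the form for r = l minus the squared mean, and the
  \<open>PC\<close> terms supply those for the other r, so together they complete the sum over all
  cells. This holds for any precoder with square-integrable products.\<close>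

lemma (in prob_space) SINR_closed_form:
  fixes a :: "'l::finite \<Rightarrow> 'k::finite \<Rightarrow> complex ^ 'l"
  assumes sq: "\<And>r k'. sq_int M (\<lambda>x. hdot (w r k' x) (g l k r x))"
  shows "complex_of_real (SINR M \<sigma> a w g l k) =
     complex_of_real ((cmod (hdot (a l k) (b_vec M w g l k)))\<^sup>2) /
     ((\<Sum>r\<in>UNIV. hdot (a r k) (C_mat M w g l k k *v a r k))
      - complex_of_real ((cmod (hdot (a l k) (b_vec M w g l k)))\<^sup>2)
      + (\<Sum>r\<in>UNIV. \<Sum>k'\<in>UNIV - {k}. hdot (a r k') (C_mat M w g l k k' *v a r k'))
      + complex_of_real (\<sigma>\<^sup>2))"
proof -
  let ?F = "\<lambda>v k' x. \<Sum>n\<in>UNIV. cnj (v $ n) * hdot (w n k' x) (g l k n x)"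
  have quad: "complex_of_real (\<integral>x. (cmod (?F v k' x))\<^sup>2 \<partial>M) = hdot v (C_mat M w g l k k' *v v)" for v k'
    unfolding expectation_cmod_sum_square[OF sq] by (simp add: C_mat_def cnj_hdot)
  have int: "integrable M (\<lambda>x. hdot (w r k' x) (g l k r x))" for r k'
    by (intro sq_int_integrable sq)
  have mean: "(\<integral>x. ?F v k x \<partial>M) = hdot v (b_vec M w g l k)" for v
    by (simp add: int hdot_def[of v] b_vec_def)
  have DS: "DS M a w g l k = hdot (a l k) (b_vec M w g l k)"
    by (simp add: DS_def hdot_def[of "a l k"] b_vec_def)
  have "BU M a w g l k x = ?F (a l k) k x - (\<integral>y. ?F (a l k) k y \<partial>M)" for x
    by (simp add: BU_def int sum_subtractf right_diff_distrib)
  then have BU: "(\<integral>x. (cmod (BU M a w g l k x))\<^sup>2 \<partial>M)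
      = (\<integral>x. (cmod (?F (a l k) k x))\<^sup>2 \<partial>M) - (cmod (hdot (a l k) (b_vec M w g l k)))\<^sup>2"
    unfolding mean[symmetric]
    by (simp only:) (intro expectation_cmod_deviation_square sq_int_sum sq_int_cmult sq)
  have "(\<Sum>r\<in>UNIV. hdot (a r k) (C_mat M w g l k k *v a r k))
      = hdot (a l k) (C_mat M w g l k k *v a l k)
      + (\<Sum>r\<in>UNIV - {l}. hdot (a r k) (C_mat M w g l k k *v a r k))"
    by (subst sum.remove[of _ l]) auto
  then show ?thesis
    unfolding SINR_def DS BU PC_def NI_def of_real_divide of_real_add of_real_diff of_real_sum quad
    by (simp add: algebra_simps)
qed

context cellular_system
begin

abbreviation q where "q \<equiv> complex_of_real (sqrt (real \<tau>p * \<eta>))"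

lemma gain_square: "q * q = complex_of_real (real \<tau>p * \<eta>)"
  using power_pos by (simp flip: of_real_mult)

text \<open>Write g = c u + x with |c| = 1. Then |g|^2 = P + Q + conj(c) h + c conj(h), where P =
  |u|^2, Q = |x|^2 and h = u^H x. After squaring, only (P + Q)^2 and 2 |h|^2 have nonzero mean.
  Collecting tr(R R), 2 u^H R u and P^2 into the trace of the squared second moment leaves the two
  correction terms.\<close>

lemma expectation_channel_norm_fourth:
  "(\<integral>w. hdot (g l k r w) (g l k r w) * hdot (g l k r w) (g l k r w) \<partial>M)
    = trace (second_moment M (g l k r) ** second_moment M (g l k r)) + (trace (R l k r))\<^sup>2
      + 2 * hdot (gbar l k r) (gbar l k r) * trace (R l k r)"
proof -
  define u where "u = gbar l k r"
  define S where "S = R l k r"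
  let ?x = "gt l k r"
  let ?c = "\<lambda>w. cis (\<theta> l k r w)"
  define P where "P = hdot u u"
  define Q where "Q w = hdot (?x w) (?x w)" for w
  define h where "h w = hdot u (?x w)" for w
  let ?A = "{Phase l k r}" and ?B = "{Scatter l k r}"
  note x4 = circ_gaussian_fourth_int[OF scatter, of l k r]
  note x2 = fourth_int_sq_int[OF x4]
  have AB: "?A \<inter> ?B = {}" by simp
  have theta [measurable]: "\<theta> l k r \<in> borel_measurable M"
    using distributed_measurable[OF phase] by simp
  have c_meas: "?c \<in> borel_measurable (sources ?A)" "(\<lambda>w. cnj (?c w)) \<in> borel_measurable (sources ?A)"
    by (intro measurable_compose[OF _ measurable_cnj] measurable_compose[OF _ measurable_cis]
        phase_measurable_sources; simp)+
  have c_meas_M: "?c \<in> borel_measurable M"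
    by (rule measurable_compose[OF _ measurable_cis]) simp
  have c_sq: "sq_int M (\<lambda>w. ?c w * F w)" if "sq_int M F" for F
    using that c_meas_M by (auto simp: sq_int_def norm_mult)
  have cc_sq: "sq_int M (\<lambda>w. cnj (?c w) * F w)" if "sq_int M F" for F
    using sq_int_cnj[OF c_sq[OF sq_int_cnj[OF that]]] by simp
  have one: "sq_int M (\<lambda>w. 1)" by (simp add: sq_int_def)
  have c_int: "integrable M ?c" "integrable M (\<lambda>w. cnj (?c w))"
    using sq_int_integrable[OF c_sq[OF one]] sq_int_integrable[OF cc_sq[OF one]] by auto
  have cc_int: "integrable M (\<lambda>w. ?c w * ?c w)" "integrable M (\<lambda>w. cnj (?c w) * cnj (?c w))"
    using sq_int_integrable[OF c_sq[OF c_sq[OF one]]] sq_int_integrable[OF cc_sq[OF cc_sq[OF one]]] by auto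
  have c_mean: "(\<integral>w. ?c w \<partial>M) = 0" "(\<integral>w. cnj (?c w) \<partial>M) = 0"
    using integral_uniform_phase[OF phase] by simp_all
  have x_meas: "(\<lambda>w. ?x w $ i) \<in> borel_measurable (sources ?B)" for i
    by (intro scatter_measurable_sources) simp
  have h_meas: "h \<in> borel_measurable (sources ?B)"
    unfolding h_def by (intro hdot_measurable x_meas) auto
  have Q_meas: "Q \<in> borel_measurable (sources ?B)"
    unfolding Q_def by (intro hdot_measurable x_meas)
  have h_sq: "sq_int M h"
    unfolding h_def hdot_def by (intro sq_int_sum sq_int_cmult x2)
  have Q_sq: "sq_int M Q"
    unfolding Q_def by (intro sq_int_hdot x4)
  have PQ_sq: "sq_int M (\<lambda>w. P + Q w)"
    using sq_int_add[OF sq_int_cmult[OF one, of P] Q_sq] by simp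
  note ints = sq_int_integrable[OF h_sq] sq_int_integrable[OF Q_sq]
  have N: "hdot (g l k r w) (g l k r w) = P + Q w + cnj (?c w) * h w + ?c w * cnj (h w)" for w
  proof -
    have "cnj (g l k r w $ i) * g l k r w $ i
        = cnj (u $ i) * u $ i + cnj (?x w $ i) * ?x w $ i
        + cnj (?c w) * (cnj (u $ i) * ?x w $ i) + ?c w * (cnj (?x w $ i) * u $ i)" for i
    proof -
      have "cnj (?c w) * ?c w = 1" by (simp add: cis_cnj cis_mult)
      then have "cnj (?c w) * (?c w * t) = t" for t by (simp flip: mult.assoc)
      then show ?thesis by (simp add: channel_nth u_def algebra_simps del: cis_cnj)
    qed
    then show ?thesis
      by (simp add: hdot_def P_def Q_def h_def sum.distrib sum_distrib_left mult_ac del: cis_cnj)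
  qed
  have NN: "hdot (g l k r w) (g l k r w) * hdot (g l k r w) (g l k r w)
      = (P + Q w) * (P + Q w) + 2 * (cnj (?c w) * ((P + Q w) * h w)) + 2 * (?c w * ((P + Q w) * cnj (h w)))
        + (cnj (?c w) * cnj (?c w)) * (h w * h w) + (?c w * ?c w) * (cnj (h w) * cnj (h w))
        + 2 * (h w * cnj (h w))" for w
  proof -
    have "cnj (?c w) * ?c w = 1" by (simp add: cis_cnj cis_mult)
    then have "cnj (?c w) * (?c w * t) = t" for t by (simp flip: mult.assoc)
    \<comment> \<open>The only use of |c| = 1: the product of the two cross terms becomes
      |h|^2.\<close>
    from this[of "h w * cnj (h w)"] show ?thesis unfolding N by algebra
  qed
  have int: "integrable M (\<lambda>w. (P + Q w) * (P + Q w))"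
    "integrable M (\<lambda>w. cnj (?c w) * ((P + Q w) * h w))" "integrable M (\<lambda>w. ?c w * ((P + Q w) * cnj (h w)))"
    "integrable M (\<lambda>w. (cnj (?c w) * cnj (?c w)) * (h w * h w))"
    "integrable M (\<lambda>w. (?c w * ?c w) * (cnj (h w) * cnj (h w)))"
    "integrable M (\<lambda>w. h w * cnj (h w))"
    using sq_int_mult_integrable[OF PQ_sq PQ_sq] sq_int_mult_integrable[OF cc_sq[OF PQ_sq] h_sq]
      sq_int_mult_integrable[OF c_sq[OF PQ_sq] sq_int_cnj[OF h_sq]]
      sq_int_mult_integrable[OF cc_sq[OF cc_sq[OF h_sq]] h_sq]
      sq_int_mult_integrable[OF c_sq[OF c_sq[OF sq_int_cnj[OF h_sq]]] sq_int_cnj[OF h_sq]]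
      sq_int_mult[OF h_sq h_sq]
    by (simp_all only: mult.assoc)
  have QE: "(\<integral>w. Q w \<partial>M) = trace S"
    unfolding Q_def hdot_def trace_def S_def
    by (simp add: sq_int_mult_integrable sq_int_cnj x2 circ_gaussian_cov[OF scatter] mult.commute[of "cnj _"] sq_int_mult)
  have QQ: "(\<integral>w. Q w * Q w \<partial>M) = (trace S)\<^sup>2 + trace (S ** S)"
  proof -
    have eq: "Q w * Q w = (\<Sum>i\<in>UNIV. \<Sum>j\<in>UNIV. ?x w $ i * cnj (?x w $ i) * (?x w $ j * cnj (?x w $ j)))" for w
      unfolding Q_def hdot_def sum_product by (simp add: mult_ac)
    have "integrable M (\<lambda>w. ?x w $ i * cnj (?x w $ i) * (?x w $ j * cnj (?x w $ j)))" for i j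
      by (intro sq_int_mult_integrable fourth_int_mult fourth_int_cnj x4)
    then show ?thesis
      unfolding eq
      by (simp add: circ_gaussian_fourth_moment[OF scatter] S_def trace_def matrix_matrix_mult_def
          sum.distrib power2_eq_square sum_product)
  qed
  have hh: "(\<integral>w. h w * h w \<partial>M) = 0"
  proof -
    have eq: "h w * h w = (\<Sum>i\<in>UNIV. \<Sum>j\<in>UNIV. cnj (u $ i) * cnj (u $ j) * (?x w $ i * ?x w $ j))" for w
      unfolding h_def hdot_def sum_product by (simp add: mult_ac)
    show ?thesis unfolding eq
      by (simp add: sq_int_mult_integrable x2 circ_gaussian_pseudo_cov[OF scatter])
  qed
  have chh: "(\<integral>w. cnj (h w) * cnj (h w) \<partial>M) = 0"
    using arg_cong[OF hh, of cnj] by (simp flip: complex_cnj_mult)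
  have hch: "(\<integral>w. h w * cnj (h w) \<partial>M) = (\<Sum>i\<in>UNIV. \<Sum>j\<in>UNIV. cnj (u $ i) * u $ j * S $ i $ j)"
  proof -
    have eq: "h w * cnj (h w) = (\<Sum>i\<in>UNIV. \<Sum>j\<in>UNIV. cnj (u $ i) * u $ j * (?x w $ i * cnj (?x w $ j)))" for w
      unfolding h_def hdot_def cnj_sum sum_product by (simp add: mult_ac)
    show ?thesis unfolding eq
      by (simp add: sq_int_mult x2 circ_gaussian_cov[OF scatter] S_def)
  qed
  have PQ: "(\<integral>w. (P + Q w) * (P + Q w) \<partial>M) = P * P + 2 * P * trace S + (trace S)\<^sup>2 + trace (S ** S)"
  proof -
    have "(P + Q w) * (P + Q w) = P * P + 2 * P * Q w + Q w * Q w" for w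
      by (simp add: algebra_simps)
    then show ?thesis
      using ints sq_int_mult_integrable[OF Q_sq Q_sq] by (simp add: prob_space QE QQ)
  qed
  \<comment> \<open>The first two expectations vanish through the mean of the phase, the last two
    through E h^2 = 0, a consequence of the circular symmetry of x.\<close>
  have zero: "(\<integral>w. cnj (?c w) * ((P + Q w) * h w) \<partial>M) = 0" "(\<integral>w. ?c w * ((P + Q w) * cnj (h w)) \<partial>M) = 0"
    "(\<integral>w. (cnj (?c w) * cnj (?c w)) * (h w * h w) \<partial>M) = 0"
    "(\<integral>w. (?c w * ?c w) * (cnj (h w) * cnj (h w)) \<partial>M) = 0"
    by (subst expectation_mult_indep[OF AB];
        (intro borel_measurable_times borel_measurable_add borel_measurable_const
            measurable_compose[OF _ measurable_cnj, of h] c_meas h_meas Q_meas c_int cc_int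
            sq_int_mult_integrable PQ_sq h_sq sq_int_cnj)?;
        simp only: c_mean hh chh mult_zero_left mult_zero_right)+
  have "(\<integral>w. hdot (g l k r w) (g l k r w) * hdot (g l k r w) (g l k r w) \<partial>M)
      = P * P + 2 * P * trace S + (trace S)\<^sup>2 + trace (S ** S)
        + 2 * (\<Sum>i\<in>UNIV. \<Sum>j\<in>UNIV. cnj (u $ i) * u $ j * S $ i $ j)"
    unfolding NN using int by (simp add: zero PQ hch del: cis_cnj)
  moreover have "trace ((S + outer u u) ** (S + outer u u))
      = trace (S ** S) + 2 * (\<Sum>i\<in>UNIV. \<Sum>j\<in>UNIV. cnj (u $ i) * u $ j * S $ i $ j) + P * P"
  proof -
    have "trace ((S + outer u u) ** (S + outer u u))
        = (\<Sum>i\<in>UNIV. \<Sum>j\<in>UNIV. S $ i $ j * S $ j $ i) + (\<Sum>i\<in>UNIV. \<Sum>j\<in>UNIV. cnj (u $ i) * u $ j * S $ i $ j)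
        + (\<Sum>i\<in>UNIV. \<Sum>j\<in>UNIV. cnj (u $ j) * u $ i * S $ j $ i) + (\<Sum>i\<in>UNIV. \<Sum>j\<in>UNIV. (cnj (u $ i) * u $ i) * (cnj (u $ j) * u $ j))"
      unfolding trace_def matrix_matrix_mult_def
      by (simp add: outer_def sum.distrib[symmetric] algebra_simps)
    \<comment> \<open>Both mixed terms equal u^H S u after exchanging the names of the indices,
      which explains the factor 2.\<close>
    also have "(\<Sum>i\<in>UNIV. \<Sum>j\<in>UNIV. cnj (u $ j) * u $ i * S $ j $ i)
        = (\<Sum>i\<in>UNIV. \<Sum>j\<in>UNIV. cnj (u $ i) * u $ j * S $ i $ j)"
      by (rule sum.swap)
    finally show ?thesis
      by (simp add: trace_def matrix_matrix_mult_def P_def hdot_def sum_product)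
  qed
  moreover have "second_moment M (g l k r) = S + outer u u"
    unfolding S_def u_def by (rule second_moment_channel[OF phase scatter noise ind])
  ultimately show ?thesis by (simp add: P_def u_def S_def)
qed

section \<open>Entries of the vector b and the matrices C\<close>

lemma disjoint_channel_interference:
  "channel_sources l k r \<inter> (pilot_sources r k - channel_sources l k r) = {}"
  by auto

lemma disjoint_channel_other_pilot:
  "k' \<noteq> k \<Longrightarrow> pilot_sources r k' \<inter> channel_sources l k r = {}"
  by (auto simp: pilot_sources_def channel_sources_def)

lemma disjoint_base_stations:
  "r \<noteq> n \<Longrightarrow> (pilot_sources r k' \<union> channel_sources l k r) \<inter> (pilot_sources n k' \<union> channel_sources l k n) = {}"
  by (auto simp: pilot_sources_def channel_sources_def)

lemma expectation_channel_norm: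
  "(\<integral>w. hdot (g l k r w) (g l k r w) \<partial>M) = trace (second_moment M (g l k r))"
  unfolding hdot_def trace_def
  by (simp add: second_moment_nth channel_sq_int sq_int_mult_integrable sq_int_cnj mult.commute[of "cnj _"] sq_int_mult)

lemma expectation_interference_channel:
  "(\<integral>w. hdot (interference l k r w) (g l k r w) \<partial>M) = 0"
  by (rule expectation_hdot_indep[OF disjoint_channel_interference[unfolded Int_commute[of "channel_sources _ _ _"]]])
    (auto intro: interference_measurable_sources channel_measurable_sources
      simp: interference_sq_int channel_sq_int interference_mean)

lemma hdot_pilot_channel:
  "hdot (z r k w) (g l k r w) = q * hdot (g l k r w) (g l k r w) + hdot (interference l k r w) (g l k r w)"
  "hdot (g l k r w) (z r k w) = q * hdot (g l k r w) (g l k r w) + hdot (g l k r w) (interference l k r w)"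
  by (simp_all add: hdot_def pilot_nth[of r k w _ l] algebra_simps sum.distrib sum_distrib_left)

lemma pilot_channel_sq_int: "sq_int M (\<lambda>w. hdot (z r k' w) (g l k r w))"
  by (intro sq_int_hdot pilot_fourth_int channel_fourth_int)

text \<open>Only the part of the pilot along the channel itself contributes, as the interference is
  centred and independent of it.\<close>

lemma expectation_pilot_channel:
  "(\<integral>w. hdot (z r k w) (g l k r w) \<partial>M) = q * trace (second_moment M (g l k r))"
proof -
  have "integrable M (\<lambda>w. hdot (g l k r w) (g l k r w))"
    "integrable M (\<lambda>w. hdot (interference l k r w) (g l k r w))"
    by (intro sq_int_integrable sq_int_hdot interference_fourth_int channel_fourth_int)+
  then show ?thesis
    by (simp add: hdot_pilot_channel expectation_channel_norm expectation_interference_channel)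
qed

text \<open>The cross terms vanish by independence and centring. The identity serves to absorb the
  interference into the full pilot correlation in \<open>expectation_same_pilot\<close>.\<close>

lemma second_moment_pilot:
  "second_moment M (z r k) $ i $ j
    = q * q * second_moment M (g l k r) $ i $ j + second_moment M (interference l k r) $ i $ j"
proof -
  have eq: "z r k w $ i * cnj (z r k w $ j)
      = q * q * (g l k r w $ i * cnj (g l k r w $ j))
        + q * (g l k r w $ i * cnj (interference l k r w $ j))
        + q * (cnj (g l k r w $ j) * interference l k r w $ i)
        + interference l k r w $ i * cnj (interference l k r w $ j)" for w
    by (simp add: pilot_nth[of r k w _ l] algebra_simps)
  have "(\<integral>w. g l k r w $ i * cnj (interference l k r w $ j) \<partial>M)
      = (\<integral>w. g l k r w $ i \<partial>M) * (\<integral>w. cnj (interference l k r w $ j) \<partial>M)"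
    "(\<integral>w. cnj (g l k r w $ j) * interference l k r w $ i \<partial>M)
      = (\<integral>w. cnj (g l k r w $ j) \<partial>M) * (\<integral>w. interference l k r w $ i \<partial>M)"
    by (intro expectation_mult_indep[OF disjoint_channel_interference[of l k r]]
        measurable_compose[OF _ measurable_cnj] channel_measurable_sources order_refl
        interference_measurable_sources sq_int_integrable sq_int_cnj channel_sq_int interference_sq_int)+
  then have cross: "(\<integral>w. g l k r w $ i * cnj (interference l k r w $ j) \<partial>M) = 0"
    "(\<integral>w. cnj (g l k r w $ j) * interference l k r w $ i \<partial>M) = 0"
    by (simp_all add: channel_mean interference_mean)
  have "integrable M (\<lambda>w. g l k r w $ i * cnj (g l k r w $ j))"
    "integrable M (\<lambda>w. g l k r w $ i * cnj (interference l k r w $ j))"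
    "integrable M (\<lambda>w. cnj (g l k r w $ j) * interference l k r w $ i)"
    "integrable M (\<lambda>w. interference l k r w $ i * cnj (interference l k r w $ j))"
    by (intro sq_int_mult_integrable sq_int_cnj channel_sq_int interference_sq_int)+
  then show ?thesis
    by (simp add: second_moment_nth pilot_sq_int channel_sq_int interference_sq_int eq cross)
qed

text \<open>With N = |g|^2, |z^H g|^2 = q^2 N^2 + q N (y^H g + g^H y) + |y^H g|^2. The middle terms
  are linear in y given g and have mean zero. The trace inside E N^2 joins the trace from |y^H g|^2
  to form the trace with the pilot correlation; the rest of E N^2 stays as the two extra
  terms.\<close>

lemma expectation_same_pilot:
  "(\<integral>w. hdot (z r k w) (g l k r w) * hdot (g l k r w) (z r k w) \<partial>M)
    = q * q * (trace (R l k r))\<^sup>2 + 2 * (q * q) * hdot (gbar l k r) (gbar l k r) * trace (R l k r)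
      + trace (second_moment M (z r k) ** second_moment M (g l k r))"
proof -
  let ?y = "interference l k r" and ?g = "g l k r"
  let ?N = "\<lambda>w. hdot (?g w) (?g w)"
  have N_sq: "sq_int M ?N" by (intro sq_int_hdot channel_fourth_int)
  have N_meas: "?N \<in> borel_measurable (sources (channel_sources l k r))"
    by (intro hdot_measurable channel_measurable_sources order_refl)
  have yg: "sq_int M (\<lambda>w. hdot (?y w) (?g w))" "sq_int M (\<lambda>w. hdot (?g w) (?y w))"
    by (intro sq_int_hdot channel_fourth_int interference_fourth_int)+
  have eq: "hdot (z r k w) (?g w) * hdot (?g w) (z r k w)
      = q * q * (?N w * ?N w) + q * (?N w * hdot (?y w) (?g w)) + q * (?N w * hdot (?g w) (?y w))
        + hdot (?y w) (?g w) * hdot (?g w) (?y w)" for w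
    unfolding hdot_pilot_channel by (simp add: algebra_simps)
  have cross: "(\<integral>w. ?N w * hdot (?g w) (?y w) \<partial>M) = 0"
  proof -
    \<comment> \<open>Everything except y_i depends on the channel sources alone, so y_i splits off
      with its zero mean.\<close>
    have "(\<integral>w. (?N w * cnj (?g w $ i)) * ?y w $ i \<partial>M)
        = (\<integral>w. ?N w * cnj (?g w $ i) \<partial>M) * (\<integral>w. ?y w $ i \<partial>M)" for i
      by (intro expectation_mult_indep[OF disjoint_channel_interference[of l k r]] borel_measurable_times
          measurable_compose[OF _ measurable_cnj] N_meas channel_measurable_sources order_refl
          interference_measurable_sources sq_int_mult N_sq sq_int_integrable channel_sq_int
          interference_sq_int)
    then have "(\<integral>w. (?N w * cnj (?g w $ i)) * ?y w $ i \<partial>M) = 0" for i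
      by (simp add: interference_mean)
    moreover have "integrable M (\<lambda>w. (?N w * cnj (?g w $ i)) * ?y w $ i)" for i
    proof -
      have "integrable M (\<lambda>w. ?N w * (cnj (?g w $ i) * ?y w $ i))"
        by (intro sq_int_mult_integrable N_sq fourth_int_mult fourth_int_cnj channel_fourth_int
            interference_fourth_int)
      then show ?thesis by (simp only: mult.assoc)
    qed
    moreover have "?N w * hdot (?g w) (?y w) = (\<Sum>i\<in>UNIV. (?N w * cnj (?g w $ i)) * ?y w $ i)" for w
      by (subst (2) hdot_def) (simp only: sum_distrib_left mult.assoc)
    ultimately show ?thesis by simp
  qed
  \<comment> \<open>The conjugate of \<open>cross\<close>, N being real.\<close>
  have cross': "(\<integral>w. ?N w * hdot (?y w) (?g w) \<partial>M) = 0"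
    using Bochner_Integration.integral_cnj[of M "\<lambda>w. ?N w * hdot (?g w) (?y w)"]
    unfolding cross complex_cnj_mult cnj_hdot by simp
  have yg_sq: "(\<integral>w. hdot (?y w) (?g w) * hdot (?g w) (?y w) \<partial>M)
      = trace (second_moment M ?y ** second_moment M ?g)"
    by (rule expectation_hdot_square_indep[OF
          disjoint_channel_interference[unfolded Int_commute[of "channel_sources _ _ _"]]])
      (auto intro: interference_measurable_sources channel_measurable_sources
        simp: interference_fourth_int channel_fourth_int)
  have "trace (second_moment M (z r k) ** second_moment M ?g)
      = q * q * trace (second_moment M ?g ** second_moment M ?g)
        + trace (second_moment M ?y ** second_moment M ?g)"
    by (simp add: trace_def matrix_matrix_mult_def second_moment_pilot[of r k _ _ l] distrib_right sum.distrib
        sum_distrib_left mult.assoc)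
  moreover have "(\<integral>w. hdot (z r k w) (?g w) * hdot (?g w) (z r k w) \<partial>M)
      = q * q * (\<integral>w. ?N w * ?N w \<partial>M) + trace (second_moment M ?y ** second_moment M ?g)"
    unfolding eq using sq_int_mult_integrable[OF N_sq N_sq] sq_int_mult_integrable[OF N_sq yg(1)]
      sq_int_mult_integrable[OF N_sq yg(2)] sq_int_mult_integrable[OF yg]
    by (simp add: cross cross' yg_sq)
  ultimately show ?thesis
    unfolding expectation_channel_norm_fourth by (simp add: algebra_simps)
qed

lemma expectation_other_pilot:
  assumes "k' \<noteq> k"
  shows "(\<integral>w. hdot (z r k' w) (g l k r w) * hdot (g l k r w) (z r k' w) \<partial>M)
    = trace (second_moment M (z r k') ** second_moment M (g l k r))"
  by (rule expectation_hdot_square_indep[OF disjoint_channel_other_pilot[OF assms]])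
    (auto intro: pilot_measurable_sources channel_measurable_sources
      simp: pilot_fourth_int channel_fourth_int)

lemma expectation_other_pilot_channel:
  assumes "k' \<noteq> k"
  shows "(\<integral>w. hdot (z r k' w) (g l k r w) \<partial>M) = 0"
  by (rule expectation_hdot_indep[OF disjoint_channel_other_pilot[OF assms]])
    (auto intro: pilot_measurable_sources channel_measurable_sources
      simp: pilot_sq_int channel_sq_int pilot_mean)

lemma expectation_distinct_base_stations:
  assumes "r \<noteq> n"
  shows "(\<integral>w. hdot (z r k' w) (g l k r w) * hdot (g l k n w) (z n k' w) \<partial>M)
    = (\<integral>w. hdot (z r k' w) (g l k r w) \<partial>M) * cnj (\<integral>w. hdot (z n k' w) (g l k n w) \<partial>M)"
proof -
  have "integrable M (\<lambda>w. hdot (z r k' w) (g l k r w))" for r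
    by (intro sq_int_integrable pilot_channel_sq_int)
  moreover have "integrable M (\<lambda>w. hdot (g l k n w) (z n k' w))"
    by (intro sq_int_integrable sq_int_hdot pilot_fourth_int channel_fourth_int)
  ultimately have "(\<integral>w. hdot (z r k' w) (g l k r w) * hdot (g l k n w) (z n k' w) \<partial>M)
      = (\<integral>w. hdot (z r k' w) (g l k r w) \<partial>M) * (\<integral>w. hdot (g l k n w) (z n k' w) \<partial>M)"
    by (intro expectation_mult_indep[OF disjoint_base_stations[OF assms, of k' l k]]
        hdot_measurable pilot_measurable_sources channel_measurable_sources) auto
  also have "(\<integral>w. hdot (g l k n w) (z n k' w) \<partial>M) = cnj (\<integral>w. hdot (z n k' w) (g l k n w) \<partial>M)"
    using Bochner_Integration.integral_cnj[of M "\<lambda>w. hdot (z n k' w) (g l k n w)"] by (simp only: cnj_hdot)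
  finally show ?thesis .
qed

lemma expectation_pilot_vec: "(\<integral>w. z r k w \<partial>M) = 0"
  by (simp add: vec_eq_iff integral_vec_nth sq_int_integrable pilot_sq_int pilot_mean)

end

section \<open>Assembly of the spectral efficiency formula\<close>

theorem theorem2:
  fixes M :: "'w measure"
    and \<theta> :: "'l::finite \<Rightarrow> 'k::finite \<Rightarrow> 'l \<Rightarrow> 'w \<Rightarrow> real"
    and gbar :: "'l \<Rightarrow> 'k \<Rightarrow> 'l \<Rightarrow> complex ^ 'm::finite"
    and gt :: "'l \<Rightarrow> 'k \<Rightarrow> 'l \<Rightarrow> 'w \<Rightarrow> complex ^ 'm"
    and nn :: "'l \<Rightarrow> 'k \<Rightarrow> 'w \<Rightarrow> complex ^ 'm"
    and R Rbar :: "'l \<Rightarrow> 'k \<Rightarrow> 'l \<Rightarrow> complex ^ 'm ^ 'm"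
    and \<Psi> :: "'l \<Rightarrow> 'k \<Rightarrow> complex ^ 'm ^ 'm"
    and g :: "'l \<Rightarrow> 'k \<Rightarrow> 'l \<Rightarrow> 'w \<Rightarrow> complex ^ 'm"
    and z :: "'l \<Rightarrow> 'k \<Rightarrow> 'w \<Rightarrow> complex ^ 'm"
    and a :: "'l \<Rightarrow> 'k \<Rightarrow> complex ^ 'l"
    and b :: "'l \<Rightarrow> 'k \<Rightarrow> complex ^ 'l"
    and C :: "'l \<Rightarrow> 'k \<Rightarrow> 'k \<Rightarrow> complex ^ 'l ^ 'l"
    and \<tau>c \<tau>p :: nat
    and \<eta> \<sigma> :: real
    and l :: 'l and k :: 'k
  assumes "prob_space M"
    and "\<tau>p = CARD('k)" and "\<tau>p < \<tau>c" and "0 < \<eta>" and "0 < \<sigma>\<^sup>2"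
    and "\<And>l k r. distributed M lborel (\<theta> l k r)
           (\<lambda>t. indicator {0..<2 * pi} t / (2 * pi))"
    and "\<And>l k r. circ_gaussian M (gt l k r) (R l k r)"
    and "\<And>l k. circ_gaussian M (nn l k) (mat (complex_of_real (\<sigma>\<^sup>2)))"
    and "prob_space.indep_sets M (source_events M \<theta> gt nn) UNIV"
    and "g = channel \<theta> gbar gt"
    and "z = pilot_obs \<tau>p \<eta> g nn"
    and "\<And>l k r. Rbar l k r = second_moment M (g l k r)"
    and "\<And>l k. \<Psi> l k = second_moment M (z l k)"
    and "b = b_vec M z g"
    and "C = C_mat M z g"
  shows "spectral_efficiency M \<tau>c \<tau>p \<sigma> a z g l k =
           (real \<tau>c - real \<tau>p) / real \<tau>c * log 2 (1 + SINR M \<sigma> a z g l k)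
       \<and> complex_of_real (SINR M \<sigma> a z g l k) =
           complex_of_real ((cmod (hdot (a l k) (b l k)))\<^sup>2) /
           ((\<Sum>r\<in>UNIV. hdot (a r k) (C l k k *v a r k))
            - complex_of_real ((cmod (hdot (a l k) (b l k)))\<^sup>2)
            + (\<Sum>r\<in>UNIV. \<Sum>k'\<in>UNIV - {k}. hdot (a r k') (C l k k' *v a r k'))
            + complex_of_real (\<sigma>\<^sup>2))
       \<and> (\<forall>r. b l k $ r = (\<integral>x. hdot (z r k x) (g l k r x) \<partial>M)
            \<and> b l k $ r = complex_of_real (sqrt (real \<tau>p * \<eta>)) * trace (Rbar l k r))
       \<and> (\<forall>r. C l k k $ r $ r
                = (\<integral>x. hdot (z r k x) (g l k r x) * hdot (g l k r x) (z r k x) \<partial>M)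
            \<and> C l k k $ r $ r
                = complex_of_real (real \<tau>p * \<eta>) * (trace (R l k r))\<^sup>2
                + 2 * complex_of_real (real \<tau>p * \<eta>) * hdot (gbar l k r) (gbar l k r) * trace (R l k r)
                + trace (\<Psi> r k ** Rbar l k r))
       \<and> (\<forall>r n. r \<noteq> n \<longrightarrow>
              C l k k $ r $ n
                = (\<integral>x. hdot (z r k x) (g l k r x) * hdot (g l k n x) (z n k x) \<partial>M)
            \<and> C l k k $ r $ n = b l k $ r * cnj (b l k $ n))
       \<and> (\<forall>k' r. k' \<noteq> k \<longrightarrow>
              C l k k' $ r $ r
                = (\<integral>x. hdot (z r k' x) (g l k r x) * hdot (g l k r x) (z r k' x) \<partial>M)
            \<and> C l k k' $ r $ r = trace (\<Psi> r k' ** Rbar l k r))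
       \<and> (\<forall>k' r n. k' \<noteq> k \<and> r \<noteq> n \<longrightarrow>
              C l k k' $ r $ n
                = (\<integral>x. hdot (z r k' x) (g l k r x) * hdot (g l k n x) (z n k' x) \<partial>M)
            \<and> C l k k' $ r $ n
                = hdot (\<integral>x. z r k' x \<partial>M) (\<integral>x. g l k r x \<partial>M)
                * hdot (\<integral>x. g l k n x \<partial>M) (\<integral>x. z n k' x \<partial>M)
            \<and> C l k k' $ r $ n = 0)"
proof -
  interpret prob_space M by fact
  have g: "g = channel \<theta> gbar gt" and z: "z = pilot_obs \<tau>p \<eta> (channel \<theta> gbar gt) nn"
    using assms(10,11) by simp_all
  interpret cellular_system M \<theta> gbar gt nn R \<sigma> \<tau>p \<eta>
    by unfold_locales (use assms in auto)
  have SINR: "complex_of_real (SINR M \<sigma> a z g l k) =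
           complex_of_real ((cmod (hdot (a l k) (b l k)))\<^sup>2) /
           ((\<Sum>r\<in>UNIV. hdot (a r k) (C l k k *v a r k))
            - complex_of_real ((cmod (hdot (a l k) (b l k)))\<^sup>2)
            + (\<Sum>r\<in>UNIV. \<Sum>k'\<in>UNIV - {k}. hdot (a r k') (C l k k' *v a r k'))
            + complex_of_real (\<sigma>\<^sup>2))"
    unfolding assms(14,15) g z by (rule SINR_closed_form) (rule pilot_channel_sq_int)
  have b: "b l k $ r = (\<integral>x. hdot (z r k x) (g l k r x) \<partial>M)" for r
    by (simp add: assms(14) b_vec_def)
  have C: "C l k k' $ r $ n = (\<integral>x. hdot (z r k' x) (g l k r x) * hdot (g l k n x) (z n k' x) \<partial>M)" for k' r n
    by (simp add: assms(15) C_mat_def)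
  have b_eq: "b l k $ r = complex_of_real (sqrt (real \<tau>p * \<eta>)) * trace (Rbar l k r)" for r
    unfolding b assms(12) g z by (rule expectation_pilot_channel)
  have C_same: "C l k k $ r $ r
      = complex_of_real (real \<tau>p * \<eta>) * (trace (R l k r))\<^sup>2
        + 2 * complex_of_real (real \<tau>p * \<eta>) * hdot (gbar l k r) (gbar l k r) * trace (R l k r)
        + trace (\<Psi> r k ** Rbar l k r)" for r
    unfolding C assms(12,13) g z gain_square[symmetric] by (rule expectation_same_pilot)
  have C_same_off: "C l k k $ r $ n = b l k $ r * cnj (b l k $ n)" if "r \<noteq> n" for r n
    unfolding C b g z by (rule expectation_distinct_base_stations[OF that])
  have C_other: "C l k k' $ r $ r = trace (\<Psi> r k' ** Rbar l k r)" if "k' \<noteq> k" for k' r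
    unfolding C assms(12,13) g z by (rule expectation_other_pilot[OF that])
  have C_other_off: "C l k k' $ r $ n = 0" if "k' \<noteq> k" "r \<noteq> n" for k' r n
    unfolding C g z expectation_distinct_base_stations[OF that(2)]
    by (simp add: expectation_other_pilot_channel[OF that(1)])
  \<comment> \<open>In the product of means every inner product now has a zero vector as one
    argument, so the product agrees with the vanishing entry.\<close>
  have z_mean: "(\<integral>x. z r k' x \<partial>M) = 0" for r k'
    unfolding z by (rule expectation_pilot_vec)
  show ?thesis
    unfolding spectral_efficiency_def
    using SINR b b_eq C C_same C_same_off C_other C_other_off
    by (intro conjI allI impI) (simp_all add: z_mean hdot_def[of 0])
qed

end
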